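(* Let $n,t\ge1$ be integers with $n\ge2^{22}$ and $n\ge2^{10}t^3\log_2 n$. Let $\mathcal{F}\subset\Sigma_n$ be a family of permutations that avoids intersection $t-1$, and put $q=32t^2\log_2 n$. Then there exist a $t$-intersecting family $\mathcal{S}$ of partial permutations, each of size at most $q$, and a family $\mathcal{F}'\subset\mathcal{F}$ such that: (i) every permutation in $\mathcal{F}\setminus\mathcal{F}'$ contains some member of $\mathcal{S}$; (ii) for every $B\in\mathcal{S}$ there is a family $\mathcal{F}_B\subset\mathcal{F}$ of permutations extending $B$ such that $\mathcal{F}_B(B)$ is $(\Sigma_n(B),2^{1/(8t)})$-homogeneous; (iii) $|\mathcal{F}'|\le n^{-4t}\,n!$.
   Context: Each permutation $\sigma$ of $[n]$ is identified with its graph $\{(1,\sigma(1)),\dots,(n,\sigma(n))\}\subset[n]^2$, so $\Sigma_n\subset\binom{[n]^2}{n}$ and intersections of permutations are intersections of these sets. A partial permutation is a set $S\subset[n]^2$ contained in the graph of some permutation. $\mathcal{F}$ avoids intersection $t-1$ if $|\sigma\cap\pi|\ne t-1$ for all $\sigma,\pi\in\mathcal{F}$. A family is $t$-intersecting if any two of its members share at least $t$ elements. For a family $\mathcal{G}$ and a set $S$, $\mathcal{G}(S)=\{A\setminus S: A\in\mathcal{G},\ S\subset A\}$. For families $\mathcal{G}\subset\mathcal{B}$ and $\tau>1$, $\mathcal{G}$ is $(\mathcal{B},\tau)$-homogeneous if for every set $S$, $\frac{|\mathcal{G}(S)|}{|\mathcal{G}|}\le\tau^{|S|}\frac{|\mathcal{B}(S)|}{|\mathcal{B}|}$.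 *)

theory Defs
  imports Complex_Main "HOL-Combinatorics.Permutations"
begin

definition perm_graph :: "nat \<Rightarrow> (nat \<Rightarrow> nat) \<Rightarrow> (nat \<times> nat) set" where
  "perm_graph n \<sigma> = {(i, \<sigma> i) | i. i \<in> {1..n}}"

definition perm_family :: "nat \<Rightarrow> (nat \<times> nat) set set" where
  "perm_family n = perm_graph n ` {\<sigma>. \<sigma> permutes {1..n}}"

definition partial_permutation :: "nat \<Rightarrow> (nat \<times> nat) set \<Rightarrow> bool" where
  "partial_permutation n S \<longleftrightarrow> (\<exists>A \<in> perm_family n. S \<subseteq> A)"

definition avoids_intersection :: "'a set set \<Rightarrow> nat \<Rightarrow> bool" where
  "avoids_intersection \<F> k \<longleftrightarrow> (\<forall>A \<in> \<F>. \<forall>B \<in> \<F>. card (A \<inter> B) \<noteq> k)"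

text \<open>The two members may coincide, so every member has at least \<open>t\<close> elements.\<close>

definition t_intersecting :: "nat \<Rightarrow> 'a set set \<Rightarrow> bool" where
  "t_intersecting t \<S> \<longleftrightarrow> (\<forall>A \<in> \<S>. \<forall>B \<in> \<S>. t \<le> card (A \<inter> B))"

definition link :: "'a set set \<Rightarrow> 'a set \<Rightarrow> 'a set set" where
  "link \<G> S = {A - S | A. A \<in> \<G> \<and> S \<subseteq> A}"

text \<open>Nonemptiness of \<open>\<G>\<close> is implicit in the quotient by \<open>card \<G>\<close>; without it
  the empty family would be homogeneous because \<open>x / 0 = 0\<close>.\<close>

definition homogeneous :: "'a set set \<Rightarrow> real \<Rightarrow> 'a set set \<Rightarrow> bool" where
  "homogeneous \<B> \<tau> \<G> \<longleftrightarrow>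
     \<G> \<subseteq> \<B> \<and> \<G> \<noteq> {} \<and> 1 < \<tau> \<and>
     (\<forall>S. real (card (link \<G> S)) / real (card \<G>)
            \<le> \<tau> ^ card S * (real (card (link \<B> S)) / real (card \<B>)))"

end

theory Submission
  imports Defs
begin

text \<open>
  The family \<open>\<S>\<close> is found greedily: take a set \<open>B\<close> of maximal size on which the density of the
  current family, relative to all permutations, is at least \<open>\<tau> ^ card B\<close> times its global density.
  Maximality makes the link at \<open>B\<close> homogeneous; remove the permutations containing \<open>B\<close> and repeat.
  Once \<open>card B > q\<close>, what is left has density less than \<open>\<tau> powr (- q)\<close>.

  For the intersection property, let \<open>B1\<close>, \<open>B2\<close> share only \<open>t - 1 - r\<close> elements, choose random
  members of their two homogeneous families, and let \<open>Z\<close> count the common elements in the grid \<open>R \<times> C\<close>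
  of rows and columns used by neither \<open>B1\<close> nor \<open>B2\<close>. The \<open>j\<close>-th factorial moment of \<open>Z\<close> is
  \<open>j! \<Sum>S. p1 S * p2 S\<close>, where \<open>p1\<close>, \<open>p2\<close> are the containment probabilities. Homogeneity bounds them
  above by \<open>\<tau> ^ j\<close> times their averages, so the moment is at most \<open>U = \<tau> ^ j\<close>; and since
  \<open>(U - u) * (U - v) \<ge> 0\<close> for the normalised probabilities \<open>u\<close>, \<open>v\<close> of average about 1,
  the moment is also at least about \<open>U * (2 - U)\<close>. For \<open>j \<le> r + 3\<close> all these numbers
  are so close to 1 that the Bonferroni inequality gives \<open>Z = r\<close> with positive probability, even after
  discarding the pairs that meet in the symmetric difference of \<open>B1\<close> and \<open>B2\<close>. Such a pair meets in
  exactly \<open>t - 1\<close> elements.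
\<close>

subsection \<open>Falling factorials and permutations\<close>

text \<open>The falling factorial, with a real argument so that factors can be compared without
  truncated subtraction. At a natural number below \<open>j\<close> it vanishes.\<close>

definition falling :: "real \<Rightarrow> nat \<Rightarrow> real" where
  "falling x j = (\<Prod>i<j. x - real i)"

lemma fact_times_binomial: "fact j * real (N choose j) = falling (real N) j"
  unfolding falling_def binomial_gbinomial
  using gbinomial_mult_fact[of j "real N"] by (simp add: atLeast0LessThan)

lemma falling_times_fact: "j \<le> N \<Longrightarrow> falling (real N) j * fact (N - j) = fact N"
  unfolding fact_times_binomial[symmetric]
  using binomial_fact_lemma[of j N]
  by (metis (mono_tags, lifting) mult.assoc mult.commute of_nat_fact of_nat_mult)

lemma falling_pos: "real j \<le> x \<Longrightarrow> 0 < falling x j"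
  unfolding falling_def by (intro prod_pos) auto

lemma falling_Suc: "falling x (Suc j) = falling x j * (x - real j)"
  by (simp add: falling_def)

section \<open>Permutation graphs and the extensions of a partial permutation\<close>

lemma perm_familyD:
  assumes "A \<in> perm_family n"
  shows "finite A" "card A = n" "inj_on fst A" "inj_on snd A"
    "fst ` A = {1..n}" "snd ` A = {1..n}" "A \<subseteq> {1..n} \<times> {1..n}"
proof -
  obtain \<sigma> where s: "\<sigma> permutes {1..n}" and A: "A = perm_graph n \<sigma>"
    using assms by (auto simp: perm_family_def)
  have A': "A = (\<lambda>i. (i, \<sigma> i)) ` {1..n}"
    unfolding A perm_graph_def by auto
  show "finite A" unfolding A' by simp
  show "card A = n" unfolding A' by (subst card_image) (auto simp: inj_on_def)
  show "inj_on fst A" unfolding A' by (auto simp: inj_on_def)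
  show "inj_on snd A" unfolding A'
    using permutes_inj[OF s] by (auto simp: inj_on_def)
  show "fst ` A = {1..n}" unfolding A' by (simp add: image_image)
  show "snd ` A = {1..n}" unfolding A' using permutes_image[OF s] by (simp add: image_image)
  then show "A \<subseteq> {1..n} \<times> {1..n}" unfolding A'
    by (auto simp: image_image)
qed

lemma finite_perm_family: "finite (perm_family n)"
  unfolding perm_family_def by (simp add: finite_permutations)

lemma inj_on_perm_graph: "inj_on (perm_graph n) {\<sigma>. \<sigma> permutes {1..n}}"
proof (rule inj_onI, clarify)
  fix \<sigma> \<pi> assume s: "\<sigma> permutes {1..n}" and p: "\<pi> permutes {1..n}"
    and e: "perm_graph n \<sigma> = perm_graph n \<pi>"
  show "\<sigma> = \<pi>"
  proof
    fix i
    show "\<sigma> i = \<pi> i"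
    proof (cases "i \<in> {1..n}")
      case True
      then have "(i, \<sigma> i) \<in> perm_graph n \<pi>" using e by (auto simp: perm_graph_def)
      then show ?thesis by (auto simp: perm_graph_def)
    next
      case False
      then show ?thesis using s p by (metis permutes_not_in)
    qed
  qed
qed

lemma card_perm_family: "card (perm_family n) = fact n"
  unfolding perm_family_def
  by (subst card_image[OF inj_on_perm_graph]) (simp add: card_permutations)

lemma partial_permutation_card:
  assumes "partial_permutation n B"
  shows "finite B" "card B \<le> n" "card (fst ` B) = card B" "card (snd ` B) = card B"
    "fst ` B \<subseteq> {1..n}" "snd ` B \<subseteq> {1..n}"
proof -
  obtain A where A: "A \<in> perm_family n" and BA: "B \<subseteq> A"
    using assms by (auto simp: partial_permutation_def)
  note P = perm_familyD[OF A]
  show "finite B" using BA P(1) finite_subset by blast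
  show "card B \<le> n" using BA P(1,2) card_mono by blast
  show "card (fst ` B) = card B" "card (snd ` B) = card B"
    using P(3,4) BA card_image inj_on_subset by blast+
  show "fst ` B \<subseteq> {1..n}" "snd ` B \<subseteq> {1..n}" 
    using image_mono[OF BA, of fst] image_mono[OF BA, of snd] P(5,6) by simp_all
qed

text \<open>Fix one extension \<open>\<pi>\<close> of \<open>B\<close>. The extensions are exactly
  the \<open>\<pi> \<circ> \<rho>\<close>, where \<open>\<rho>\<close> permutes the rows that
  \<open>B\<close> does not use.\<close>

lemma card_perm_family_containing:
  assumes "partial_permutation n B"
  shows "card {A \<in> perm_family n. B \<subseteq> A} = fact (n - card B)"
proof -
  obtain \<pi> where p: "\<pi> permutes {1..n}" and B: "B \<subseteq> perm_graph n \<pi>"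
    using assms by (auto simp: partial_permutation_def perm_family_def)
  note P = partial_permutation_card[OF assms]
  let ?I = "{1..n} - fst ` B"
  have snd: "snd x = \<pi> (fst x)" if "x \<in> B" for x
    using that B by (auto simp: perm_graph_def)
  have iff: "B \<subseteq> perm_graph n \<sigma> \<longleftrightarrow> (\<forall>i \<in> fst ` B. \<sigma> i = \<pi> i)" for \<sigma>
  proof
    assume a: "B \<subseteq> perm_graph n \<sigma>"
    show "\<forall>i \<in> fst ` B. \<sigma> i = \<pi> i"
    proof
      fix i assume "i \<in> fst ` B"
      then obtain x where x: "x \<in> B" "i = fst x" by auto
      then have "snd x = \<sigma> i" using a by (auto simp: perm_graph_def)
      then show "\<sigma> i = \<pi> i" using snd[OF x(1)] x(2) by simp
    qed
  next
    assume a: "\<forall>i \<in> fst ` B. \<sigma> i = \<pi> i"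
    show "B \<subseteq> perm_graph n \<sigma>"
    proof
      fix x assume x: "x \<in> B"
      then have "x = (fst x, \<sigma> (fst x))" "fst x \<in> {1..n}"
        using snd[OF x] a P(5) by (auto intro: prod_eqI)
      then show "x \<in> perm_graph n \<sigma>" unfolding perm_graph_def by blast
    qed
  qed
  have "{\<sigma>. \<sigma> permutes {1..n} \<and> (\<forall>i \<in> fst ` B. \<sigma> i = \<pi> i)} = (\<lambda>\<rho>. \<pi> \<circ> \<rho>) ` {\<rho>. \<rho> permutes ?I}"
    (is "?L = ?R")
  proof
    show "?R \<subseteq> ?L"
    proof clarify
      fix \<rho> assume r: "\<rho> permutes ?I"
      have "\<rho> permutes {1..n}" using r by (rule permutes_subset) auto
      then have "\<pi> \<circ> \<rho> permutes {1..n}" using p by (rule permutes_compose)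
      moreover have "\<forall>i \<in> fst ` B. (\<pi> \<circ> \<rho>) i = \<pi> i"
        using r by (auto simp: permutes_not_in)
      ultimately show "\<pi> \<circ> \<rho> permutes {1..n} \<and> (\<forall>i \<in> fst ` B. (\<pi> \<circ> \<rho>) i = \<pi> i)" ..
    qed
    show "?L \<subseteq> ?R"
    proof clarify
      fix \<sigma> assume s: "\<sigma> permutes {1..n}" and e: "\<forall>i \<in> fst ` B. \<sigma> i = \<pi> i"
      let ?r = "inv \<pi> \<circ> \<sigma>"
      have r: "?r permutes {1..n}" using s permutes_inv[OF p] by (rule permutes_compose)
      have "?r permutes ?I"
      proof (rule permutes_superset[OF r])
        show "\<And>i. i \<in> {1..n} - ?I \<Longrightarrow> ?r i = i"
          using e permutes_inverses(2)[OF p] by auto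
      qed
      moreover have "\<sigma> = \<pi> \<circ> ?r" using permutes_inverses(1)[OF p] by auto
      ultimately show "\<sigma> \<in> ?R" by blast
    qed
  qed
  moreover have "inj_on (\<lambda>\<rho>. \<pi> \<circ> \<rho>) {\<rho>. \<rho> permutes ?I}"
    using permutes_inj[OF p] by (auto simp: inj_on_def fun_eq_iff)
  moreover have "card {\<rho>. \<rho> permutes ?I} = fact (n - card B)"
    by (rule card_permutations) (use P in \<open>simp_all add: card_Diff_subset\<close>)
  ultimately have "card {\<sigma>. \<sigma> permutes {1..n} \<and> (\<forall>i \<in> fst ` B. \<sigma> i = \<pi> i)} = fact (n - card B)"
    by (simp add: card_image)
  moreover have "{A \<in> perm_family n. B \<subseteq> A}
      = perm_graph n ` {\<sigma>. \<sigma> permutes {1..n} \<and> (\<forall>i \<in> fst ` B. \<sigma> i = \<pi> i)}"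
    using iff by (auto simp: perm_family_def)
  moreover have "inj_on (perm_graph n) {\<sigma>. \<sigma> permutes {1..n} \<and> (\<forall>i \<in> fst ` B. \<sigma> i = \<pi> i)}"
    by (rule inj_on_subset[OF inj_on_perm_graph]) auto
  ultimately show ?thesis by (simp add: card_image)
qed

lemma card_link: "card (link \<G> S) = card {A \<in> \<G>. S \<subseteq> A}"
proof -
  have "link \<G> S = (\<lambda>A. A - S) ` {A \<in> \<G>. S \<subseteq> A}" by (auto simp: link_def)
  moreover have "inj_on (\<lambda>A. A - S) {A \<in> \<G>. S \<subseteq> A}" by (auto simp: inj_on_def)
  ultimately show ?thesis by (simp add: card_image)
qed

lemma link_link:
  assumes "T \<inter> S = {}"
  shows "link (link \<G> S) T = link \<G> (S \<union> T)"
proof -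
  have "X - S - T = X - (S \<union> T)" for X by auto
  moreover have "S \<subseteq> X \<and> T \<subseteq> X - S \<longleftrightarrow> S \<union> T \<subseteq> X" for X using assms by auto
  ultimately show ?thesis unfolding link_def by (smt (verit) Collect_cong mem_Collect_eq)
qed

lemma link_link_empty: "T \<inter> S \<noteq> {} \<Longrightarrow> link (link \<G> S) T = {}"
  unfolding link_def by auto

text \<open>\<open>A\<close> has \<open>card R\<close> points in the rows \<open>R\<close> and
  \<open>card C\<close> points in the columns \<open>C\<close>. All of them lie outside
  \<open>B\<close>, so their union has at most \<open>n - card B\<close> points, and
  inclusion-exclusion gives the lower bound.\<close>

lemma card_perm_Int_grid:
  assumes A: "A \<in> perm_family n" and B: "B \<subseteq> A"
    and R: "R \<subseteq> {1..n} - fst ` B" and C: "C \<subseteq> {1..n} - snd ` B"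
  shows "card (A \<inter> R \<times> C) \<le> card R"
    and "card R + card C - (n - card B) \<le> card (A \<inter> R \<times> C)"
proof -
  note P = perm_familyD[OF A]
  let ?X = "{x \<in> A. fst x \<in> R}" and ?Y = "{x \<in> A. snd x \<in> C}"
  have fR: "finite R" using R finite_subset by blast
  have X: "card ?X = card R"
  proof -
    have "fst ` ?X = R" using P(5) R by (force simp: image_iff)
    moreover have "inj_on fst ?X" by (rule inj_on_subset[OF P(3)]) auto
    ultimately show ?thesis by (metis card_image)
  qed
  have Y: "card ?Y = card C"
  proof -
    have "snd ` ?Y = C" using P(6) C by (force simp: image_iff)
    moreover have "inj_on snd ?Y" by (rule inj_on_subset[OF P(4)]) auto
    ultimately show ?thesis by (metis card_image)
  qed
  have XY: "A \<inter> R \<times> C = ?X \<inter> ?Y" by auto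
  have fin: "finite ?X" "finite ?Y" using P(1) by auto
  show "card (A \<inter> R \<times> C) \<le> card R"
    unfolding X[symmetric] XY using fin by (intro card_mono) auto
  have "?X \<union> ?Y \<subseteq> A - B" using R C by auto
  then have "card (?X \<union> ?Y) \<le> n - card B"
    using card_mono[of "A - B"] P(1,2) B card_Diff_subset[of B A] finite_subset[OF B] by auto
  then show "card R + card C - (n - card B) \<le> card (A \<inter> R \<times> C)"
    using card_Un_Int[OF fin] X Y XY by simp
qed

section \<open>Matchings in a grid of rows and columns\<close>

lemma falling_nat_Suc: "falling (real N) (Suc j) = falling (real N) j * real (N - j)"
proof (cases "j \<le> N")
  case False
  then have "falling (real N) j = 0" by (simp add: fact_times_binomial[symmetric])
  then show ?thesis by (simp add: falling_Suc)
qed (simp add: falling_Suc of_nat_diff)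

text \<open>Placements of \<open>j\<close> non-attacking rooks: the only \<open>j\<close>-element
  subsets of the grid that a permutation can contain.\<close>

definition matchings :: "'a set \<Rightarrow> 'b set \<Rightarrow> nat \<Rightarrow> ('a \<times> 'b) set set" where
  "matchings R C j = {S. S \<subseteq> R \<times> C \<and> card S = j \<and> inj_on fst S \<and> inj_on snd S}"

lemma finite_matchings: "finite R \<Longrightarrow> finite C \<Longrightarrow> finite (matchings R C j)"
  unfolding matchings_def by (rule finite_subset[of _ "Pow (R \<times> C)"]) auto

text \<open>Pair a placement of size \<open>Suc j\<close> with one of its cells. Deleting the cell
  is an injection into the pairs of a placement of size \<open>j\<close> and a cell in a free row
  and a free column.\<close>

lemma card_matchings_Suc_le:
  assumes "finite R" "finite C"
  shows "Suc j * card (matchings R C (Suc j)) \<le> card (matchings R C j) * ((card R - j) * (card C - j))"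
proof -
  let ?Q = "SIGMA S:matchings R C (Suc j). S"
  let ?T = "SIGMA S:matchings R C j. (R - fst ` S) \<times> (C - snd ` S)"
  let ?g = "\<lambda>(S, x). (S - {x}, x)"
  note fm = finite_matchings[OF assms]
  have fS: "finite S" if "S \<in> matchings R C k" for S k
    using that assms finite_subset[of S "R \<times> C"] by (simp add: matchings_def)
  have "card ?Q = (\<Sum>S\<in>matchings R C (Suc j). card S)"
    using fm fS by (intro card_SigmaI) auto
  also have "\<dots> = Suc j * card (matchings R C (Suc j))"
    by (simp add: matchings_def)
  finally have Q: "card ?Q = Suc j * card (matchings R C (Suc j))" .
  have "card ?T = (\<Sum>S\<in>matchings R C j. card ((R - fst ` S) \<times> (C - snd ` S)))"
    using fm assms by (intro card_SigmaI) auto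
  also have "\<dots> = (\<Sum>S\<in>matchings R C j. (card R - j) * (card C - j))"
  proof (rule sum.cong[OF refl])
    fix S assume S: "S \<in> matchings R C j"
    have "fst ` S \<subseteq> R" "snd ` S \<subseteq> C" using S by (auto simp: matchings_def)
    moreover have "card (fst ` S) = j" "card (snd ` S) = j"
      using S by (auto simp: matchings_def card_image)
    ultimately show "card ((R - fst ` S) \<times> (C - snd ` S)) = (card R - j) * (card C - j)"
      using fS[OF S] by (simp add: card_cartesian_product card_Diff_subset)
  qed
  finally have T: "card ?T = card (matchings R C j) * ((card R - j) * (card C - j))" by simp
  have "inj_on ?g ?Q" by (auto simp: inj_on_def)
  moreover have "?g ` ?Q \<subseteq> ?T"
  proof
    fix y assume "y \<in> ?g ` ?Q"
    then obtain S a b where y: "y = (S - {(a, b)}, a, b)"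
      and S: "S \<in> matchings R C (Suc j)" and x: "(a, b) \<in> S" by auto
    have "S - {(a, b)} \<in> matchings R C j"
      using S x fS[OF S] by (auto simp: matchings_def intro: inj_on_subset)
    moreover have "a \<in> R" "b \<in> C" using S x by (auto simp: matchings_def)
    moreover have "a \<notin> fst ` (S - {(a, b)})" "b \<notin> snd ` (S - {(a, b)})"
      using S x by (fastforce simp: matchings_def inj_on_def)+
    ultimately show "y \<in> ?T" using y by auto
  qed
  moreover have "finite ?T" using fm assms by (intro finite_SigmaI) auto
  ultimately have "card ?Q \<le> card ?T" by (rule card_inj_on_le)
  then show ?thesis unfolding Q T .
qed

lemma fact_times_card_matchings_le:
  assumes "finite R" "finite C"
  shows "fact j * real (card (matchings R C j)) \<le> falling (card R) j * falling (card C) j"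
proof (induction j)
  case 0
  have "matchings R C 0 = {{}}"
    using finite_subset[OF _ finite_cartesian_product[OF assms]] by (auto simp: matchings_def)
  then show ?case by (simp add: falling_def)
next
  case (Suc j)
  have "fact (Suc j) * real (card (matchings R C (Suc j)))
      = fact j * real (Suc j * card (matchings R C (Suc j)))" by (simp add: algebra_simps)
  also have "\<dots> \<le> fact j * real (card (matchings R C j) * ((card R - j) * (card C - j)))"
    using card_matchings_Suc_le[OF assms] by (intro mult_left_mono of_nat_mono) auto
  also have "\<dots> = (fact j * real (card (matchings R C j))) * (real (card R - j) * real (card C - j))"
    by simp
  also have "\<dots> \<le> (falling (card R) j * falling (card C) j) * (real (card R - j) * real (card C - j))"
    by (intro mult_right_mono Suc) auto
  finally show ?case by (simp add: falling_nat_Suc mult_ac)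
qed

subsection \<open>Homogeneous families and the greedy decomposition\<close>

text \<open>Turns quotients of link sizes into a count of members through \<open>S\<close>: if
  \<open>B \<union> S\<close> is a partial permutation, the proportion of permutations through
  \<open>B\<close> that contain \<open>S\<close> is the reciprocal of
  \<open>falling (n - card B) (card S)\<close>.\<close>

lemma homogeneous_linkD:
  assumes B: "partial_permutation n B" and F: "\<F> \<subseteq> perm_family n" "\<forall>A \<in> \<F>. B \<subseteq> A"
    and hom: "homogeneous (link (perm_family n) B) \<tau> (link \<F> B)"
    and S: "S \<inter> B = {}"
  shows "\<F> \<noteq> {}"
    and "real (card {A \<in> \<F>. S \<subseteq> A}) * falling (real (n - card B)) (card S) \<le> \<tau> ^ card S * real (card \<F>)"
proof -
  show ne: "\<F> \<noteq> {}" using hom by (auto simp: homogeneous_def link_def)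
  have fF: "finite \<F>" using F(1) finite_perm_family finite_subset by blast
  then have cF: "card \<F> > 0" using ne by (simp add: card_gt_0_iff)
  have tau: "\<tau> > 1" using hom by (simp add: homogeneous_def)
  show "real (card {A \<in> \<F>. S \<subseteq> A}) * falling (real (n - card B)) (card S) \<le> \<tau> ^ card S * real (card \<F>)"
  proof (cases "{A \<in> \<F>. S \<subseteq> A} = {}")
    case True
    then have "card {A \<in> \<F>. S \<subseteq> A} = 0" by (simp only: card.empty)
    then show ?thesis using tau by simp
  next
    case False
    then obtain A where A: "A \<in> \<F>" "S \<subseteq> A" by auto
    \<comment> \<open>The member \<open>A\<close> through both sets certifies this; without such a
      member the left side is zero.\<close>
    have BS: "partial_permutation n (B \<union> S)"
      using A F unfolding partial_permutation_def by blast
    have fin: "finite (B \<union> S)" using partial_permutation_card(1)[OF BS] .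
    have c: "card (B \<union> S) = card B + card S"
      using fin S by (subst card_Un_disjoint) auto
    then have le: "card S \<le> n - card B" using partial_permutation_card(2)[OF BS] by simp
    have 1: "card (link \<F> B) = card \<F>"
      unfolding card_link using F(2) by (intro arg_cong[of _ _ card]) auto
    have 2: "card (link (link \<F> B) S) = card {A \<in> \<F>. S \<subseteq> A}"
      unfolding link_link[OF S] card_link using F(2) by (intro arg_cong[of _ _ card]) auto
    have 3: "card (link (link (perm_family n) B) S) = fact (n - card B - card S)"
      unfolding link_link[OF S] card_link card_perm_family_containing[OF BS] c by simp
    have 4: "card (link (perm_family n) B) = fact (n - card B)"
      unfolding card_link card_perm_family_containing[OF B] ..
    have "real (card (link (link \<F> B) S)) / real (card (link \<F> B))
        \<le> \<tau> ^ card S * (real (card (link (link (perm_family n) B) S)) / real (card (link (perm_family n) B)))"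
      using hom by (simp add: homogeneous_def)
    then have "real (card {A \<in> \<F>. S \<subseteq> A}) / real (card \<F>)
        \<le> \<tau> ^ card S * (fact (n - card B - card S) / fact (n - card B))"
      unfolding 1 2 3 4 by simp
    also have "\<dots> = \<tau> ^ card S / falling (real (n - card B)) (card S)"
      using falling_times_fact[OF le] falling_pos[of "card S" "real (n - card B)"] le
      by (simp add: field_simps)
    finally show ?thesis
      using cF falling_pos[of "card S" "real (n - card B)"] le by (simp add: field_simps)
  qed
qed

text \<open>Strong induction on \<open>card \<F>\<close>. The chosen \<open>B\<close> lies in some
  member of \<open>\<F>\<close>, so removing the members through it makes the family strictly
  smaller, and the families found later are still subfamilies of \<open>\<F>\<close>.\<close>

lemma greedy_decomposition:
  fixes \<tau> q :: real
  assumes tau: "1 < \<tau>" and F: "\<F> \<subseteq> perm_family n"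
  shows "\<exists>\<S> \<F>'. (\<forall>B \<in> \<S>. partial_permutation n B \<and> real (card B) \<le> q) \<and>
      \<F>' \<subseteq> \<F> \<and> (\<forall>\<sigma> \<in> \<F> - \<F>'. \<exists>B \<in> \<S>. B \<subseteq> \<sigma>) \<and>
      (\<forall>B \<in> \<S>. \<exists>\<F>B. \<F>B \<subseteq> \<F> \<and> (\<forall>\<sigma> \<in> \<F>B. B \<subseteq> \<sigma>) \<and>
          homogeneous (link (perm_family n) B) \<tau> (link \<F>B B)) \<and>
      real (card \<F>') \<le> \<tau> powr (- q) * fact n"
  using F
proof (induction "card \<F>" arbitrary: \<F> rule: less_induct)
  case less
  let ?P = "perm_family n"
  let ?F = "\<lambda>S. {A \<in> \<F>. S \<subseteq> A}" and ?S = "\<lambda>S. {A \<in> ?P. S \<subseteq> A}"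
  have fF: "finite \<F>" using less.prems finite_perm_family finite_subset by blast
  show ?case
  proof (cases "\<F> = {}")
    case True
    then show ?thesis using tau by (intro exI[of _ "{}"]) auto
  next
    case False
    then have cF: "card \<F> > 0" using fF by (simp add: card_gt_0_iff)
    \<comment> \<open>The density condition, multiplied out. Nonemptiness excludes sets contained in
      no permutation, for which both sides are zero, and thereby bounds
      \<open>card S\<close>.\<close>
    define dense where "dense S \<longleftrightarrow> ?F S \<noteq> {} \<and>
      \<tau> ^ card S * card (?S S) * card \<F> \<le> real (card (?F S)) * fact n" for S
    have d0: "dense {}" using False by (simp add: dense_def card_perm_family)
    have bound: "card S \<le> n" if "dense S" for S
    proof -
      obtain A where A: "A \<in> \<F>" "S \<subseteq> A" using \<open>dense S\<close> by (auto simp: dense_def)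
      then have "A \<in> ?P" using less.prems by auto
      then show ?thesis using perm_familyD(1,2) card_mono[OF _ A(2)] by metis
    qed
    obtain B where B: "dense B" and max: "\<And>S. dense S \<Longrightarrow> card S \<le> card B"
      using ex_has_greatest_nat[of dense "{}" card "Suc n", OF d0] bound less_Suc_eq_le by metis
    obtain A where A: "A \<in> \<F>" "B \<subseteq> A" using B by (auto simp: dense_def)
    have pB: "partial_permutation n B"
      using A less.prems by (auto simp: partial_permutation_def)
    have cS: "card (?S B) > 0" using card_perm_family_containing[OF pB] by simp
    have sub: "?F S \<subseteq> ?S S" for S using less.prems by auto
    have fS: "finite (?S S)" for S using finite_perm_family by auto
    show ?thesis
    proof (cases "real (card B) \<le> q")
      case False
      \<comment> \<open>Since \<open>?F B \<subseteq> ?S B\<close>, density at a large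
        \<open>B\<close> forces \<open>\<F>\<close> itself to be small, so all of it can serve as
        \<open>\<F>'\<close>.\<close>
      have "\<tau> ^ card B * card \<F> * card (?S B) \<le> real (card (?F B)) * fact n"
        using B by (simp add: dense_def mult_ac)
      also have "\<dots> \<le> fact n * card (?S B)"
        using card_mono[OF fS sub, of B] by simp
      finally have "\<tau> ^ card B * card \<F> \<le> fact n" using cS by simp
      then have "card \<F> \<le> fact n / \<tau> ^ card B" using tau by (simp add: field_simps)
      also have "\<dots> = \<tau> powr (- real (card B)) * fact n"
        using tau by (simp add: powr_minus powr_realpow field_simps)
      also have "\<dots> \<le> \<tau> powr (- q) * fact n"
        using False tau by (intro mult_right_mono powr_mono) auto
      finally have small: "card \<F> \<le> \<tau> powr (- q) * fact n" .
      show ?thesis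
        by (rule exI[of _ "{}"], rule exI[of _ \<F>]) (use small in simp)
    next
      case True
      have FB0: "?F B \<noteq> {}" using A by auto
      then have cFB: "card (?F B) > 0" using fF by (simp add: card_gt_0_iff)
      have hom: "homogeneous (link ?P B) \<tau> (link (?F B) B)"
        unfolding homogeneous_def
      proof (intro conjI allI)
        show "link (?F B) B \<subseteq> link ?P B" using less.prems by (auto simp: link_def)
        show "link (?F B) B \<noteq> {}" using FB0 by (auto simp: link_def)
        show "1 < \<tau>" by (rule tau)
        fix T
        have l1: "card (link (?F B) B) = card (?F B)"
          unfolding card_link by (intro arg_cong[of _ _ card]) auto
        show "real (card (link (link (?F B) B) T)) / real (card (link (?F B) B))
          \<le> \<tau> ^ card T * (real (card (link (link ?P B) T)) / real (card (link ?P B)))"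
        \<comment> \<open>If \<open>T\<close> meets \<open>B\<close>, or no member of
          \<open>\<F>\<close> contains \<open>B \<union> T\<close>, the link at \<open>T\<close> is
          empty and the left side is zero.\<close>
        proof (cases "T \<inter> B = {} \<and> ?F (B \<union> T) \<noteq> {}")
          case False
          have "link (link (?F B) B) T = {}"
          proof (cases "T \<inter> B = {}")
            case True
            then show ?thesis using False link_link[OF True] by (auto simp: link_def)
          qed (rule link_link_empty)
          then show ?thesis using tau by simp
        next
          case True
          then have TB: "T \<inter> B = {}" and ne: "?F (B \<union> T) \<noteq> {}" by auto
          then obtain A' where A': "A' \<in> \<F>" "B \<union> T \<subseteq> A'" by auto
          then have "A' \<in> ?P" using less.prems by auto
          then have fin: "finite (B \<union> T)" using perm_familyD(1) A'(2) finite_subset by metis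
          have c: "card (B \<union> T) = card B + card T"
            using fin TB by (subst card_Un_disjoint) auto
          have l2: "card (link (link (?F B) B) T) = card (?F (B \<union> T))"
            unfolding link_link[OF TB] card_link by (intro arg_cong[of _ _ card]) auto
          have "real (card (?F (B \<union> T))) * card (?S B) \<le> \<tau> ^ card T * card (?S (B \<union> T)) * card (?F B)"
          proof (cases "T = {}")
            case False
            then have "card (B \<union> T) > card B" using c fin by (simp add: card_gt_0_iff)
            \<comment> \<open>By \<open>ne\<close> only the inequality in \<open>dense\<close> can
              fail. Density of \<open>B\<close> then absorbs the factor
              \<open>\<tau> ^ card B\<close>, and \<open>\<tau> ^ card T\<close> remains.\<close>
            then have "\<not> dense (B \<union> T)" using max by fastforce
            then have "real (card (?F (B \<union> T))) * fact n
                \<le> \<tau> ^ card (B \<union> T) * card (?S (B \<union> T)) * card \<F>"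
              using ne unfolding dense_def by linarith
            then have "real (card (?F (B \<union> T))) * fact n * card (?S B)
                \<le> \<tau> ^ card (B \<union> T) * card (?S (B \<union> T)) * card \<F> * card (?S B)"
              by (rule mult_right_mono) simp
            also have "\<dots> = \<tau> ^ card T * card (?S (B \<union> T)) * (\<tau> ^ card B * card (?S B) * card \<F>)"
              by (simp add: c power_add mult_ac)
            also have "\<dots> \<le> \<tau> ^ card T * card (?S (B \<union> T)) * (real (card (?F B)) * fact n)"
              using B tau by (intro mult_left_mono) (auto simp: dense_def)
            finally have "fact n * (real (card (?F (B \<union> T))) * card (?S B))
                \<le> fact n * (\<tau> ^ card T * card (?S (B \<union> T)) * card (?F B))"
              by (simp add: mult_ac)
            then show ?thesis by (simp only: mult_le_cancel_left_pos[OF fact_gt_zero])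
          qed simp
          then show ?thesis
            unfolding l1 l2 link_link[OF TB] card_link using cS cFB by (simp add: field_simps)
        qed
      qed
      have lt: "card (\<F> - ?F B) < card \<F>"
        using A fF by (intro psubset_card_mono) auto
      have subP: "\<F> - ?F B \<subseteq> ?P" using less.prems by auto
      obtain \<S> \<F>' where IH: "\<forall>B \<in> \<S>. partial_permutation n B \<and> real (card B) \<le> q"
        "\<F>' \<subseteq> \<F> - ?F B" "\<forall>\<sigma> \<in> (\<F> - ?F B) - \<F>'. \<exists>B \<in> \<S>. B \<subseteq> \<sigma>"
        "\<forall>B' \<in> \<S>. \<exists>\<F>B. \<F>B \<subseteq> \<F> - ?F B \<and> (\<forall>\<sigma> \<in> \<F>B. B' \<subseteq> \<sigma>) \<and>
          homogeneous (link (perm_family n) B') \<tau> (link \<F>B B')"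
        "real (card \<F>') \<le> \<tau> powr (- q) * fact n"
        using less.hyps[OF lt subP] by (elim exE conjE) (rule that; assumption)
      show ?thesis
      proof (rule exI[of _ "insert B \<S>"], rule exI[of _ \<F>'], intro conjI)
        show "\<forall>B\<in>insert B \<S>. partial_permutation n B \<and> real (card B) \<le> q"
          using IH(1) pB True by auto
        show "\<F>' \<subseteq> \<F>" using IH(2) by auto
        show "\<forall>\<sigma>\<in>\<F> - \<F>'. \<exists>B\<in>insert B \<S>. B \<subseteq> \<sigma>" using IH(3) by blast
        show "\<forall>B'\<in>insert B \<S>. \<exists>\<F>B. \<F>B \<subseteq> \<F> \<and> (\<forall>\<sigma> \<in> \<F>B. B' \<subseteq> \<sigma>) \<and>
          homogeneous (link ?P B') \<tau> (link \<F>B B')"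
        proof
          fix B' assume "B' \<in> insert B \<S>"
          then consider "B' = B" | "B' \<in> \<S>" by auto
          then show "\<exists>\<F>B. \<F>B \<subseteq> \<F> \<and> (\<forall>\<sigma> \<in> \<F>B. B' \<subseteq> \<sigma>) \<and>
            homogeneous (link ?P B') \<tau> (link \<F>B B')"
          proof cases
            case 1
            then show ?thesis using hom by (intro exI[of _ "?F B"]) auto
          next
            case 2
            then obtain \<F>B where "\<F>B \<subseteq> \<F> - ?F B" "\<forall>\<sigma> \<in> \<F>B. B' \<subseteq> \<sigma>"
              "homogeneous (link ?P B') \<tau> (link \<F>B B')" using IH(4) by meson
            then show ?thesis by (intro exI[of _ \<F>B]) auto
          qed
        qed
        show "real (card \<F>') \<le> \<tau> powr (- q) * fact n" by (rule IH(5))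
      qed
    qed
  qed
qed

subsection \<open>Counting and inequalities\<close>

lemma falling_add: "falling x (r + i) = falling x r * falling (x - real r) i"
  by (induction i) (simp_all add: falling_def algebra_simps)

lemma falling_self: "falling (real r) r = fact r"
  using fact_times_binomial[of r r] by simp

text \<open>For \<open>Z = r + m\<close> the left side is \<open>falling Z r\<close> times the
  alternating sum of \<open>m choose i\<close> over \<open>i \<le> 3\<close>. This cubic in
  \<open>m\<close> is 1 at 0, vanishes at 1, 2, 3 and is negative beyond. For \<open>Z < r\<close>
  every term vanishes.\<close>

lemma bonferroni_binomial:
  "falling (real Z) r - falling (real Z) (r + 1) + falling (real Z) (r + 2) / 2
      - falling (real Z) (r + 3) / 6 \<le> (if Z = r then fact r else 0)"
proof (cases "r \<le> Z")
  case False
  then have "falling (real Z) (r + i) = 0" for i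
    by (simp add: fact_times_binomial[symmetric])
  from this[of 0] this[of 1] this[of 2] this[of 3] False show ?thesis by simp
next
  case True
  then obtain m where Z: "Z = r + m" using le_Suc_ex by blast
  have f: "falling (real m) 1 = m" "falling (real m) 2 = m * (real m - 1)"
    "falling (real m) 3 = m * (real m - 1) * (real m - 2)"
    by (simp_all add: falling_def numeral_2_eq_2 numeral_3_eq_3)
  have s: "falling (real Z) (r + i) = falling (real Z) r * falling (real m) i" for i
    unfolding falling_add Z by simp
  have pos: "0 \<le> falling (real Z) r" by (simp add: fact_times_binomial[symmetric])
  have "falling (real Z) r - falling (real Z) (r + 1) + falling (real Z) (r + 2) / 2
      - falling (real Z) (r + 3) / 6
      = falling (real Z) r * (1 - real m + m * (real m - 1) / 2 - m * (real m - 1) * (real m - 2) / 6)"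
    unfolding s f by (simp add: field_simps)
  also have "1 - real m + m * (real m - 1) / 2 - m * (real m - 1) * (real m - 2) / 6
      = - ((real m - 1) * (real m - 2) * (real m - 3) / 6)"
    by (simp add: field_simps)
  finally have e: "falling (real Z) r - falling (real Z) (r + 1) + falling (real Z) (r + 2) / 2
      - falling (real Z) (r + 3) / 6
      = falling (real Z) r * - ((real m - 1) * (real m - 2) * (real m - 3) / 6)" .
  show ?thesis
  proof (cases "m = 0")
    case True
    then show ?thesis unfolding e using Z by (simp add: falling_self)
  next
    case False
    have "0 \<le> falling (real (m - 1)) 3" by (simp add: fact_times_binomial[symmetric])
    then have "0 \<le> (real m - 1) * (real m - 2) * (real m - 3)"
      using False by (simp add: falling_def numeral_3_eq_3 of_nat_diff algebra_simps)
    then show ?thesis unfolding e using Z False pos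
      by (simp add: mult_nonneg_nonneg)
  qed
qed

text \<open>Sum the pointwise inequality
  \<open>0 \<le> (\<alpha> - f x) * (\<beta> - g x)\<close>.\<close>

lemma sum_mult_lower_bound:
  fixes f g :: "'a \<Rightarrow> real"
  assumes "\<And>x. x \<in> M \<Longrightarrow> f x \<le> \<alpha>" "\<And>x. x \<in> M \<Longrightarrow> g x \<le> \<beta>"
  shows "\<beta> * sum f M + \<alpha> * sum g M - \<alpha> * \<beta> * real (card M) \<le> (\<Sum>x\<in>M. f x * g x)"
proof -
  have "\<beta> * sum f M + \<alpha> * sum g M - \<alpha> * \<beta> * real (card M)
      = (\<Sum>x\<in>M. \<beta> * f x + \<alpha> * g x - \<alpha> * \<beta>)"
    by (simp add: sum.distrib sum_subtractf sum_distrib_left mult.commute)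
  also have "\<dots> \<le> (\<Sum>x\<in>M. f x * g x)"
  proof (rule sum_mono)
    fix x assume "x \<in> M"
    then have "0 \<le> (\<alpha> - f x) * (\<beta> - g x)" using assms by simp
    then show "\<beta> * f x + \<alpha> * g x - \<alpha> * \<beta> \<le> f x * g x" by (simp add: algebra_simps)
  qed
  finally show ?thesis .
qed

text \<open>Compare factor by factor, then apply Bernoulli's inequality to
  \<open>(1 - d) ^ j\<close>.\<close>

lemma prod_ge_one_minus:
  fixes f g :: "nat \<Rightarrow> real"
  assumes "0 \<le> d" "d \<le> 1" and "\<And>i. i < j \<Longrightarrow> 0 \<le> g i" "\<And>i. i < j \<Longrightarrow> (1 - d) * g i \<le> f i"
  shows "(1 - real j * d) * (\<Prod>i<j. g i) \<le> (\<Prod>i<j. f i)"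
proof -
  have "(1 - real j * d) * (\<Prod>i<j. g i) \<le> (1 - d) ^ j * (\<Prod>i<j. g i)"
    using Bernoulli_inequality[of "- d" j] assms by (intro mult_right_mono prod_nonneg) auto
  also have "\<dots> = (\<Prod>i<j. (1 - d) * g i)" by (simp add: prod.distrib)
  also have "\<dots> \<le> (\<Prod>i<j. f i)" using assms by (intro prod_mono) auto
  finally show ?thesis .
qed

text \<open>\<open>(\<rho> + \<gamma> - x - i) * (x - i)\<close> equals \<open>(\<rho> - i) *
  (\<gamma> - i) - (x - \<rho>) * (x - \<gamma>)\<close>: first-order terms cancel, and the relative
  loss per factor is only \<open>(m / L)\<^sup>2\<close>.\<close>

lemma falling_excess_lower_bound:
  fixes x \<rho> \<gamma> m L :: real
  assumes "0 < L" "m \<le> L" "0 \<le> x - \<rho>" "x - \<rho> \<le> m" "0 \<le> x - \<gamma>" "x - \<gamma> \<le> m"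
    and "L + real j \<le> \<rho>" "L + real j \<le> \<gamma>"
  shows "(1 - real j * (m / L)\<^sup>2) * (falling \<rho> j * falling \<gamma> j) \<le> falling (\<rho> + \<gamma> - x) j * falling x j"
  unfolding falling_def prod.distrib[symmetric]
proof (rule prod_ge_one_minus)
  have m: "0 \<le> m" using assms by linarith
  show "0 \<le> (m / L)\<^sup>2" "(m / L)\<^sup>2 \<le> 1" using assms m by (simp_all add: abs_square_le_1)
  fix i assume "i < j"
  then have g: "L \<le> \<rho> - real i" "L \<le> \<gamma> - real i" using assms by auto
  then show "0 \<le> (\<rho> - real i) * (\<gamma> - real i)" using assms by (intro mult_nonneg_nonneg) auto
  have "(x - \<rho>) * (x - \<gamma>) \<le> m * m" using assms m by (intro mult_mono) auto
  also have "\<dots> = (m / L)\<^sup>2 * (L * L)" using assms by (simp add: power2_eq_square)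
  also have "\<dots> \<le> (m / L)\<^sup>2 * ((\<rho> - real i) * (\<gamma> - real i))"
    using assms g by (intro mult_left_mono mult_mono) auto
  finally show "(1 - (m / L)\<^sup>2) * ((\<rho> - real i) * (\<gamma> - real i)) \<le> (\<rho> + \<gamma> - x - real i) * (x - real i)"
    by (simp add: algebra_simps)
qed

text \<open>Here the loss is of first order: each factor drops by at most \<open>m\<close> from a
  value of at least \<open>L\<close>, and
  \<open>(1 - m / L)\<^sup>2 \<ge> 1 - 2 * m / L\<close>.\<close>

lemma falling_ratio_lower_bound:
  fixes x y \<rho> \<gamma> m L :: real
  assumes "0 < L" "2 * m \<le> L" "0 \<le> x - \<rho>" "x - \<rho> \<le> m" "0 \<le> y - \<gamma>" "y - \<gamma> \<le> m"
    and "L + real j \<le> \<rho>" "L + real j \<le> \<gamma>"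
  shows "(1 - real j * (2 * m / L)) * (falling x j * falling y j) \<le> falling \<rho> j * falling \<gamma> j"
  unfolding falling_def prod.distrib[symmetric]
proof (rule prod_ge_one_minus)
  have m: "0 \<le> m" using assms by linarith
  show "0 \<le> 2 * m / L" "2 * m / L \<le> 1" using assms m by simp_all
  fix i assume "i < j"
  then have g: "L \<le> x - real i" "L \<le> y - real i" using assms by auto
  then show "0 \<le> (x - real i) * (y - real i)" using assms by (intro mult_nonneg_nonneg) auto
  have aux: "0 \<le> (1 - m / L) * z \<and> (1 - m / L) * z \<le> z - m" if "L \<le> z" for z
  proof
    have "m / L \<le> 1" using assms m by simp
    then show "0 \<le> (1 - m / L) * z" using that assms by simp
    have "m / L * L \<le> m / L * z" using that assms m by (intro mult_left_mono) auto
    then show "(1 - m / L) * z \<le> z - m" using assms by (simp add: algebra_simps)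
  qed
  have "(1 - 2 * m / L) * ((x - real i) * (y - real i))
      \<le> (1 - m / L)\<^sup>2 * ((x - real i) * (y - real i))"
    using g assms by (intro mult_right_mono mult_nonneg_nonneg) (auto simp: power2_eq_square algebra_simps)
  also have "\<dots> = ((1 - m / L) * (x - real i)) * ((1 - m / L) * (y - real i))"
    by (simp add: power2_eq_square)
  also have "\<dots> \<le> (x - real i - m) * (y - real i - m)"
    using aux[OF g(1)] aux[OF g(2)] by (intro mult_mono) auto
  also have "\<dots> \<le> (\<rho> - real i) * (\<gamma> - real i)"
    using assms g aux[OF g(1)] aux[OF g(2)] by (intro mult_mono) auto
  finally show "(1 - 2 * m / L) * ((x - real i) * (y - real i)) \<le> (\<rho> - real i) * (\<gamma> - real i)" .
qed

section \<open>Factorial moments by double counting\<close>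

lemma sum_card_swap:
  assumes "finite X" "finite M"
  shows "(\<Sum>x\<in>X. card {s \<in> M. P s x}) = (\<Sum>s\<in>M. card {x \<in> X. P s x})"
  using sum.swap[of "\<lambda>x s. if P s x then 1::nat else 0" M X] assms
  by (simp add: sum.If_cases Int_def)

text \<open>\<open>A\<close> has one point in each row and column, so every \<open>j\<close>-subset
  of \<open>A\<close> inside the grid is a matching. \<open>X\<close> will be \<open>A\<close>
  itself for a single family and the second permutation for pairs.\<close>

lemma binomial_card_perm_Int:
  assumes A: "A \<in> perm_family n"
  shows "card (A \<inter> X \<inter> R \<times> C) choose j = card {S \<in> matchings R C j. S \<subseteq> A \<inter> X}"
proof -
  note P = perm_familyD[OF A]
  have "{S \<in> matchings R C j. S \<subseteq> A \<inter> X} = {S. S \<subseteq> A \<inter> X \<inter> R \<times> C \<and> card S = j}"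
    unfolding matchings_def using inj_on_subset[OF P(3)] inj_on_subset[OF P(4)] by auto
  then show ?thesis using n_subsets[of "A \<inter> X \<inter> R \<times> C" j] P(1) by simp
qed

lemma sum_falling_perm_Int:
  assumes F: "\<F> \<subseteq> perm_family n" and fin: "finite R" "finite C"
  shows "(\<Sum>A\<in>\<F>. falling (card (A \<inter> R \<times> C)) j)
    = fact j * (\<Sum>S\<in>matchings R C j. real (card {A \<in> \<F>. S \<subseteq> A}))"
proof -
  have fF: "finite \<F>" using F finite_perm_family finite_subset by blast
  have "(\<Sum>A\<in>\<F>. falling (card (A \<inter> R \<times> C)) j)
      = (\<Sum>A\<in>\<F>. fact j * real (card {S \<in> matchings R C j. S \<subseteq> A}))"
  proof (rule sum.cong[OF refl])
    fix A assume "A \<in> \<F>"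
    then have "A \<in> perm_family n" using F by auto
    then show "falling (card (A \<inter> R \<times> C)) j = fact j * real (card {S \<in> matchings R C j. S \<subseteq> A})"
      using binomial_card_perm_Int[of A n A R C j] by (simp add: fact_times_binomial[symmetric])
  qed
  also have "\<dots> = fact j * real (\<Sum>A\<in>\<F>. card {S \<in> matchings R C j. S \<subseteq> A})"
    by (simp add: sum_distrib_left)
  finally show ?thesis
    using sum_card_swap[OF fF finite_matchings[OF fin], where P = "(\<subseteq>)"] by simp
qed

lemma sum_falling_pair_Int:
  assumes F: "\<F> \<subseteq> perm_family n" "\<G> \<subseteq> perm_family n" and fin: "finite R" "finite C"
  shows "(\<Sum>(A, A')\<in>\<F> \<times> \<G>. falling (card (A \<inter> A' \<inter> R \<times> C)) j)
    = fact j * (\<Sum>S\<in>matchings R C j. real (card {A \<in> \<F>. S \<subseteq> A}) * real (card {A \<in> \<G>. S \<subseteq> A}))"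
proof -
  have fF: "finite (\<F> \<times> \<G>)" using F finite_perm_family finite_subset by blast
  have "(\<Sum>(A, A')\<in>\<F> \<times> \<G>. falling (card (A \<inter> A' \<inter> R \<times> C)) j)
      = (\<Sum>x\<in>\<F> \<times> \<G>. fact j * real (card {S \<in> matchings R C j. S \<subseteq> fst x \<inter> snd x}))"
  proof (rule sum.cong[OF refl])
    fix x assume "x \<in> \<F> \<times> \<G>"
    then have "fst x \<in> perm_family n" using F by auto
    then show "(case x of (A, A') \<Rightarrow> falling (card (A \<inter> A' \<inter> R \<times> C)) j)
        = fact j * real (card {S \<in> matchings R C j. S \<subseteq> fst x \<inter> snd x})"
      using binomial_card_perm_Int[of "fst x" n "snd x" R C j]
      by (simp add: fact_times_binomial[symmetric] case_prod_beta)
  qed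
  also have "\<dots> = fact j * real (\<Sum>x\<in>\<F> \<times> \<G>. card {S \<in> matchings R C j. S \<subseteq> fst x \<inter> snd x})"
    by (simp add: sum_distrib_left)
  also have "(\<Sum>x\<in>\<F> \<times> \<G>. card {S \<in> matchings R C j. S \<subseteq> fst x \<inter> snd x})
      = (\<Sum>S\<in>matchings R C j. card {x \<in> \<F> \<times> \<G>. S \<subseteq> fst x \<inter> snd x})"
    by (rule sum_card_swap[OF fF finite_matchings[OF fin]])
  \<comment> \<open>For fixed \<open>S\<close> the two members of a pair are chosen independently,
    so the count factors.\<close>
  also have "\<dots> = (\<Sum>S\<in>matchings R C j. card {A \<in> \<F>. S \<subseteq> A} * card {A \<in> \<G>. S \<subseteq> A})"
  proof (rule sum.cong[OF refl])
    fix S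
    have "{x \<in> \<F> \<times> \<G>. S \<subseteq> fst x \<inter> snd x} = {A \<in> \<F>. S \<subseteq> A} \<times> {A \<in> \<G>. S \<subseteq> A}" by auto
    then show "card {x \<in> \<F> \<times> \<G>. S \<subseteq> fst x \<inter> snd x} = card {A \<in> \<F>. S \<subseteq> A} * card {A \<in> \<G>. S \<subseteq> A}"
      by (simp only: card_cartesian_product)
  qed
  finally show ?thesis by simp
qed

lemma falling_nat_mono: "a \<le> b \<Longrightarrow> falling (real a) j \<le> falling (real b) j"
  unfolding fact_times_binomial[symmetric]
  by (intro mult_left_mono of_nat_mono binomial_right_mono) auto

lemma falling_nat_nonneg: "0 \<le> falling (real a) j"
  by (simp add: fact_times_binomial[symmetric])

text \<open>Each member meets the grid in a number of points confined by
  \<open>card_perm_Int_grid\<close>; monotonicity of \<open>falling\<close> on naturals carries the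
  two bounds over to the sum.\<close>

lemma sum_card_matchings_bounds:
  assumes F: "\<F> \<subseteq> perm_family n" "\<forall>A \<in> \<F>. B \<subseteq> A"
    and R: "R \<subseteq> {1..n} - fst ` B" and C: "C \<subseteq> {1..n} - snd ` B"
  shows "fact j * (\<Sum>S\<in>matchings R C j. real (card {A \<in> \<F>. S \<subseteq> A})) \<le> real (card \<F>) * falling (card R) j"
    and "real (card \<F>) * falling (real (card R + card C - (n - card B))) j
      \<le> fact j * (\<Sum>S\<in>matchings R C j. real (card {A \<in> \<F>. S \<subseteq> A}))"
proof -
  have fin: "finite R" "finite C" using R C finite_subset by blast+
  have b: "card (A \<inter> R \<times> C) \<le> card R" "card R + card C - (n - card B) \<le> card (A \<inter> R \<times> C)"
    if "A \<in> \<F>" for A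
    using card_perm_Int_grid[OF _ bspec[OF F(2) that] R C] F(1) that by auto
  have "(\<Sum>A\<in>\<F>. falling (card (A \<inter> R \<times> C)) j) \<le> (\<Sum>A\<in>\<F>. falling (card R) j)"
    by (intro sum_mono falling_nat_mono b)
  then show "fact j * (\<Sum>S\<in>matchings R C j. real (card {A \<in> \<F>. S \<subseteq> A})) \<le> real (card \<F>) * falling (card R) j"
    using sum_falling_perm_Int[OF F(1) fin] by simp
  have "(\<Sum>A\<in>\<F>. falling (card R + card C - (n - card B)) j) \<le> (\<Sum>A\<in>\<F>. falling (card (A \<inter> R \<times> C)) j)"
    by (intro sum_mono falling_nat_mono b)
  then show "real (card \<F>) * falling (real (card R + card C - (n - card B))) j
      \<le> fact j * (\<Sum>S\<in>matchings R C j. real (card {A \<in> \<F>. S \<subseteq> A}))"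
    using sum_falling_perm_Int[OF F(1) fin] by simp
qed

text \<open>Pull the pointwise bound on \<open>f\<close> out of the sum and bound the rest by the
  total of \<open>g\<close>.\<close>

lemma pair_sum_upper_bound:
  fixes f g :: "'a \<Rightarrow> real"
  assumes "\<And>S. S \<in> M \<Longrightarrow> f S * x \<le> U * a" "\<And>S. S \<in> M \<Longrightarrow> 0 \<le> g S"
    and "c * sum g M \<le> b * y" "0 < x" "y \<le> x" "0 \<le> U" "0 \<le> a" "0 \<le> b" "0 \<le> c"
  shows "c * (\<Sum>S\<in>M. f S * g S) \<le> U * a * b"
proof -
  have "(\<Sum>S\<in>M. f S * g S) \<le> (\<Sum>S\<in>M. U * a / x * g S)"
    using assms by (intro sum_mono mult_right_mono) (auto simp: field_simps)
  then have "c * (\<Sum>S\<in>M. f S * g S) \<le> c * (\<Sum>S\<in>M. U * a / x * g S)"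
    using assms by (intro mult_left_mono) auto
  also have "\<dots> = U * a / x * (c * sum g M)" by (simp add: sum_distrib_left mult_ac)
  also have "\<dots> \<le> U * a / x * (b * y)" using assms by (intro mult_left_mono) auto
  also have "\<dots> \<le> U * a / x * (b * x)" using assms by (intro mult_left_mono) auto
  also have "\<dots> = U * a * b" using assms by simp
  finally show ?thesis .
qed

text \<open>\<open>x\<close> and \<open>y\<close> normalise the containment counts, and
  \<open>z\<close> bounds the number of matchings times \<open>c\<close>. \<open>d\<close> measures
  the loss in the totals of \<open>f\<close> and \<open>g\<close>, and \<open>e\<close> the loss in
  passing from \<open>x * y\<close> to \<open>z\<close>.\<close>

lemma pair_sum_lower_bound:
  fixes f g :: "'a \<Rightarrow> real"
  assumes f: "\<And>S. S \<in> M \<Longrightarrow> f S * x \<le> U * a" and g: "\<And>S. S \<in> M \<Longrightarrow> g S * y \<le> U * b"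
    and sf: "a * k \<le> c * sum f M" and sg: "b * l \<le> c * sum g M" and M: "c * real (card M) \<le> z"
    and k: "(1 - d) * z \<le> k * x" and l: "(1 - d) * z \<le> l * y"
    and z: "(1 - e) * (x * y) \<le> z"
    and pos: "0 < x" "0 < y" "0 \<le> U" "0 \<le> a" "0 \<le> b" "0 \<le> c" and U: "0 \<le> 2 * (1 - d) - U"
  shows "(1 - e) * (U * (2 * (1 - d) - U)) * a * b \<le> c * (\<Sum>S\<in>M. f S * g S)"
proof -
  let ?\<alpha> = "U * a / x" and ?\<beta> = "U * b / y"
  have ab: "0 \<le> ?\<alpha>" "0 \<le> ?\<beta>" using pos by simp_all
  \<comment> \<open>Nonnegativity permits the factor \<open>1 - e\<close> to be replaced by
    \<open>z / (x * y)\<close>.\<close>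
  have P: "0 \<le> U * (2 * (1 - d) - U) * a * b"
    using pos U by (intro mult_nonneg_nonneg) auto
  have "(1 - e) * (U * (2 * (1 - d) - U)) * a * b = (1 - e) * (U * (2 * (1 - d) - U) * a * b)" by simp
  also have "\<dots> \<le> z / (x * y) * (U * (2 * (1 - d) - U) * a * b)"
    using z pos P by (intro mult_right_mono) (auto simp: field_simps)
  \<comment> \<open>The term \<open>2 * (1 - d)\<close> is shared equally by the totals of
    \<open>f\<close> and \<open>g\<close>; the square of \<open>U\<close> becomes
    \<open>?\<alpha> * ?\<beta>\<close>. This is the shape of
    \<open>sum_mult_lower_bound\<close>.\<close>
  also have "\<dots> = ?\<beta> * (a * ((1 - d) * z / x)) + ?\<alpha> * (b * ((1 - d) * z / y)) - ?\<alpha> * ?\<beta> * z"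
    using pos by (simp add: field_simps)
  also have "\<dots> \<le> ?\<beta> * (a * k) + ?\<alpha> * (b * l) - ?\<alpha> * ?\<beta> * (c * real (card M))"
    using k l M pos ab by (intro add_mono diff_mono mult_left_mono) (auto simp: pos_divide_le_eq mult_ac)
  also have "\<dots> \<le> ?\<beta> * (c * sum f M) + ?\<alpha> * (c * sum g M) - ?\<alpha> * ?\<beta> * (c * real (card M))"
    using sf sg ab by (intro add_mono diff_right_mono mult_left_mono) auto
  also have "\<dots> = c * (?\<beta> * sum f M + ?\<alpha> * sum g M - ?\<alpha> * ?\<beta> * real (card M))"
    by (simp add: algebra_simps)
  also have "\<dots> \<le> c * (\<Sum>S\<in>M. f S * g S)"
    using f g pos by (intro mult_left_mono sum_mult_lower_bound) (auto simp: pos_le_divide_eq)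
  finally show ?thesis .
qed

section \<open>Numerical estimates\<close>

lemma two_powr_eighth_le: "2 powr (1/8) \<le> ((10906/10000)::real)"
proof (rule ccontr)
  assume "\<not> ?thesis"
  then have "((10906/10000)::real) ^ 8 < (2 powr (1/8)) ^ 8" by (intro power_strict_mono) auto
  also have "\<dots> = 2" by (simp add: powr_realpow[symmetric] powr_powr)
  finally show False by (simp add: power_divide)
qed

text \<open>The reason for the exponent \<open>1 / (8 * t)\<close>: a power of order at most
  \<open>k * t\<close> costs at most the \<open>k\<close>-th power of \<open>2 powr (1/8)\<close>, a
  number just above 1.09.\<close>

lemma tau_power_bounds:
  fixes t j k :: nat
  assumes "t \<ge> 1" "j \<le> k * t"
  shows "1 \<le> (2 powr (1 / (8 * real t))) ^ j" and "(2 powr (1 / (8 * real t))) ^ j \<le> ((10906/10000)::real) ^ k"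
proof -
  have "(2 powr (1 / (8 * real t))) ^ j = 2 powr (real j / (8 * real t))"
    by (simp add: powr_realpow[symmetric] powr_powr)
  also have "\<dots> \<le> 2 powr (1/8 * real k)"
  proof (rule powr_mono)
    have "real j \<le> real k * real t" using assms(2) by (metis of_nat_le_iff of_nat_mult)
    then show "real j / (8 * real t) \<le> 1/8 * real k" using assms(1) by (simp add: field_simps)
  qed simp
  also have "\<dots> = (2 powr (1/8)) ^ k" by (simp add: powr_realpow[symmetric] powr_powr)
  also have "\<dots> \<le> (10906/10000) ^ k" by (intro power_mono two_powr_eighth_le) auto
  finally show "(2 powr (1 / (8 * real t))) ^ j \<le> ((10906/10000)::real) ^ k" .
  show "1 \<le> (2 powr (1 / (8 * real t))) ^ j"
    by (intro one_le_power ge_one_powr_ge_zero) auto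
qed

text \<open>Since \<open>u * (2 * (1 - d) - u) = 1 - (u - 1)\<^sup>2 - 2 * d * u\<close>, a
  deviation of \<open>u\<close> from 1 costs only its square, and the worst case is at
  \<open>U\<close> and \<open>D\<close>.\<close>

lemma lower_factor_bound:
  fixes a d u A D U :: real
  assumes "a \<le> A" "A \<le> 1" "d \<le> D" "1 \<le> u" "u \<le> U" "0 \<le> D" "0 \<le> 1 - (U - 1)\<^sup>2 - 2 * D * U"
  shows "(1 - A) * (1 - (U - 1)\<^sup>2 - 2 * D * U) \<le> (1 - a) * (u * (2 * (1 - d) - u))"
proof -
  have "(u - 1)\<^sup>2 \<le> (U - 1)\<^sup>2" using assms by (intro power_mono) auto
  moreover have "d * u \<le> D * u" "D * u \<le> D * U"
    using assms by (auto intro: mult_right_mono mult_left_mono)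
  moreover have "u * (2 * (1 - d) - u) = 1 - (u - 1)\<^sup>2 - 2 * d * u"
    by (simp add: power2_eq_square algebra_simps)
  ultimately have "1 - (U - 1)\<^sup>2 - 2 * D * U \<le> u * (2 * (1 - d) - u)" by linarith
  then show ?thesis using assms by (intro mult_mono) auto
qed

text \<open>If all normalised moments were 1, the right side of the last claim would be 1 - 1 + 1/2
  - 1/6 = 1/3. The actual bounds leave 0.927 - 1.0906 + 0.89/2 - 1.298/6 > 0.06, against at most
  0.0117 on the left.\<close>

lemma bonferroni_numeric_bound:
  fixes n m L \<tau> :: real and r t :: nat
  defines "\<tau> \<equiv> 2 powr (1 / (8 * real t))"
  defines "lo \<equiv> \<lambda>j. (1 - real j * (2 * m / L)) * (\<tau> ^ j * (2 * (1 - real j * (m / L)\<^sup>2) - \<tau> ^ j))"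
  assumes n: "0 < n" and m: "0 \<le> m" "32 * real t * m \<le> n" "192 * m \<le> n" and L: "L = 49/50 * n"
    and r: "r < t"
  shows "0 \<le> 2 * (1 - real r * (m / L)\<^sup>2) - \<tau> ^ r"
    and "0 \<le> 2 * (1 - real (r + 2) * (m / L)\<^sup>2) - \<tau> ^ (r + 2)"
    and "2 * m * \<tau> ^ (r + 1) / L < lo r - \<tau> ^ (r + 1) + lo (r + 2) / 2 - \<tau> ^ (r + 3) / 6"
proof -
  have t: "t \<ge> 1" using r by simp
  have L0: "0 < L" using n L by simp
  note T = tau_power_bounds[OF t, folded \<tau>_def]
  have T0: "1 \<le> \<tau> ^ r" "\<tau> ^ r \<le> 10906/10000" using T[of r 1] r by auto
  have T1: "1 \<le> \<tau> ^ (r + 1)" "\<tau> ^ (r + 1) \<le> 10906/10000" using T[of "r + 1" 1] r by auto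
  \<comment> \<open>From \<open>r < t\<close> follow \<open>r + 2 \<le> 2 * t\<close> and
    \<open>r + 3 \<le> 3 * t\<close>, with equality when \<open>t = 1\<close>; hence the square here
    and the cube next.\<close>
  have T2: "1 \<le> \<tau> ^ (r + 2)" "\<tau> ^ (r + 2) \<le> (10906/10000) ^ 2" using T[of "r + 2" 2] r by auto
  have T3: "\<tau> ^ (r + 3) \<le> (10906/10000) ^ 3" using T(2)[of "r + 3" 3] r by auto
  \<comment> \<open>The constants round up 50/(49 * 192) here and 50/(49 * 32) in
    \<open>tx\<close>.\<close>
  have x: "m / L \<le> 1/188" using m L n by (simp add: field_simps)
  have x0: "0 \<le> m / L" using m L0 by simp
  have tx: "real t * (m / L) \<le> 319/10000" using m L n by (simp add: field_simps)
  have rx: "real r * (m / L) \<le> 319/10000"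
  proof -
    have "real r * (m / L) \<le> real t * (m / L)" using r x0 by (intro mult_right_mono) auto
    then show ?thesis using tx by linarith
  qed
  have r2x: "real (r + 2) * (m / L) \<le> 373/10000"
  proof -
    have "real (r + 2) * (m / L) \<le> (real t + 1) * (m / L)" using r x0 by (intro mult_right_mono) auto
    also have "\<dots> = real t * (m / L) + m / L" by (simp add: algebra_simps)
    finally show ?thesis using tx x by linarith
  qed
  have d: "real r * (m / L)\<^sup>2 \<le> 4/10000"
  proof -
    have "real r * (m / L)\<^sup>2 = real r * (m / L) * (m / L)" by (simp add: power2_eq_square)
    also have "\<dots> \<le> 319/10000 * (1/188)" using rx x x0 by (intro mult_mono) auto
    finally show ?thesis by linarith
  qed
  have d2: "real (r + 2) * (m / L)\<^sup>2 \<le> 4/10000"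
  proof -
    have "real (r + 2) * (m / L)\<^sup>2 = real (r + 2) * (m / L) * (m / L)" by (simp add: power2_eq_square)
    also have "\<dots> \<le> 373/10000 * (1/188)" using r2x x x0 by (intro mult_mono) auto
    finally show ?thesis by linarith
  qed
  have aux: "0 \<le> 2 * (1 - D) - u" if "D \<le> 4/10000" "u \<le> 12/10" for D u :: real
    using that by simp
  show "0 \<le> 2 * (1 - real r * (m / L)\<^sup>2) - \<tau> ^ r" using T0 by (intro aux[OF d]) simp
  show "0 \<le> 2 * (1 - real (r + 2) * (m / L)\<^sup>2) - \<tau> ^ (r + 2)"
    using T2 by (intro aux[OF d2]) (simp add: power2_eq_square)
  have lo0: "927/1000 \<le> lo r"
  proof -
    have a: "real r * (2 * m / L) \<le> 638/10000" using rx by (simp add: mult_ac)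
    have "927/1000 \<le> (1 - 638/10000) * (1 - (10906/10000 - 1)\<^sup>2 - 2 * (4/10000) * (10906/10000) :: real)"
      by (simp add: power2_eq_square)
    also have "\<dots> \<le> lo r" unfolding lo_def
      by (rule lower_factor_bound[OF a _ d T0]) (simp_all add: power2_eq_square)
    finally show ?thesis .
  qed
  have lo2: "89/100 \<le> lo (r + 2)"
  proof -
    have a: "real (r + 2) * (2 * m / L) \<le> 746/10000" using r2x by (simp add: mult_ac)
    have "89/100 \<le> (1 - 746/10000) * (1 - ((10906/10000)\<^sup>2 - 1)\<^sup>2 - 2 * (4/10000) * (10906/10000)\<^sup>2 :: real)"
      by (simp add: power2_eq_square)
    also have "\<dots> \<le> lo (r + 2)" unfolding lo_def
      by (rule lower_factor_bound[OF a _ d2 T2]) (simp_all add: power2_eq_square)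
    finally show ?thesis .
  qed
  have "2 * m * \<tau> ^ (r + 1) / L = 2 * (m / L) * \<tau> ^ (r + 1)" by simp
  also have "\<dots> \<le> 2 * (1/188) * (10906/10000)" using x x0 T1 by (intro mult_mono) auto
  finally have y: "2 * m * \<tau> ^ (r + 1) / L \<le> 117/10000" by simp
  have "\<tau> ^ (r + 3) \<le> 1298/1000" using T3 by (simp add: power3_eq_cube)
  then show "2 * m * \<tau> ^ (r + 1) / L < lo r - \<tau> ^ (r + 1) + lo (r + 2) / 2 - \<tau> ^ (r + 3) / 6"
    using y lo0 lo2 T1 by linarith
qed

section \<open>The grid left free by two partial permutations\<close>

lemma card_Diff_Diff_bounds:
  fixes X Y :: "nat set"
  assumes "X \<subseteq> {1..n}" "Y \<subseteq> {1..n}"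
  shows "card ({1..n} - X - Y) \<le> n - card X" "card ({1..n} - X - Y) \<le> n - card Y"
    "n \<le> card ({1..n} - X - Y) + card X + card Y"
proof -
  have fin: "finite X" "finite Y" using assms finite_subset by blast+
  have X: "card ({1..n} - X) = n - card X" and Y: "card ({1..n} - Y) = n - card Y"
    using fin assms by (simp_all add: card_Diff_subset)
  show "card ({1..n} - X - Y) \<le> n - card X" unfolding X[symmetric] by (intro card_mono) auto
  show "card ({1..n} - X - Y) \<le> n - card Y" unfolding Y[symmetric] by (intro card_mono) auto
  have "n - card X - card Y \<le> card ({1..n} - X - Y)"
    unfolding X[symmetric] using fin by (intro diff_card_le_card_Diff) auto
  then show "n \<le> card ({1..n} - X - Y) + card X + card Y" by linarith
qed

text \<open>A point of \<open>A\<close> in a row or column used by \<open>B\<close> belongs to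
  \<open>B\<close>, because \<open>A\<close> has one point per row and column; likewise for
  \<open>A'\<close> and \<open>B'\<close>. So common points outside \<open>B\<close> and
  \<open>B'\<close> lie in the grid.\<close>

lemma card_Int_decomposition:
  assumes A: "A \<in> perm_family n" "A' \<in> perm_family n" and B: "B \<subseteq> A" "B' \<subseteq> A'"
  shows "card (A \<inter> A') = card (B \<inter> B')
    + card (A \<inter> A' \<inter> ((B - B') \<union> (B' - B)))
    + card (A \<inter> A' \<inter> ({1..n} - fst ` B - fst ` B') \<times> ({1..n} - snd ` B - snd ` B'))"
    (is "_ = card ?X + card ?Y + card ?Z")
proof -
  note P = perm_familyD[OF A(1)] and P' = perm_familyD[OF A(2)]
  have B1: "x \<in> B" if "x \<in> A" "fst x \<in> fst ` B \<or> snd x \<in> snd ` B" for x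
  proof -
    obtain y where "y \<in> B" "fst x = fst y \<or> snd x = snd y" using \<open>fst x \<in> _ \<or> _\<close> by auto
    then show ?thesis using P(3,4) B(1) \<open>x \<in> A\<close> by (metis inj_onD subsetD)
  qed
  have B2: "x \<in> B'" if "x \<in> A'" "fst x \<in> fst ` B' \<or> snd x \<in> snd ` B'" for x
  proof -
    obtain y where "y \<in> B'" "fst x = fst y \<or> snd x = snd y" using \<open>fst x \<in> _ \<or> _\<close> by auto
    then show ?thesis using P'(3,4) B(2) \<open>x \<in> A'\<close> by (metis inj_onD subsetD)
  qed
  have "A \<inter> A' = ?X \<union> ?Y \<union> ?Z"
  proof
    show "A \<inter> A' \<subseteq> ?X \<union> ?Y \<union> ?Z"
    proof
      fix x assume x: "x \<in> A \<inter> A'"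
      show "x \<in> ?X \<union> ?Y \<union> ?Z"
      proof (cases "x \<in> B \<or> x \<in> B'")
        case False
        then have "fst x \<notin> fst ` B" "snd x \<notin> snd ` B" "fst x \<notin> fst ` B'" "snd x \<notin> snd ` B'"
          using B1[of x] B2[of x] x by blast+
        moreover have "x \<in> {1..n} \<times> {1..n}" using P(7) x by blast
        ultimately show ?thesis using x by (simp add: mem_Times_iff)
      qed (use x in blast)
    qed
  qed (use B in blast)
  moreover have "?X \<inter> ?Y = {}" by blast
  moreover have "(?X \<union> ?Y) \<inter> ?Z = {}" by force
  moreover have "finite ?X" "finite ?Y" "finite ?Z"
    using P(1) B finite_subset[OF B(1)] by auto
  ultimately show ?thesis by (metis card_Un_disjoint finite_UnI)
qed

subsection \<open>Prescribed intersections\<close>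

text \<open>Bounds the weight of pairs sharing a point \<open>y\<close> that the base set of
  \<open>\<F>\<close> supplies and that of \<open>\<G>\<close> does not. Spreadness of
  \<open>\<G>\<close> at \<open>insert y S\<close> instead of \<open>S\<close> gains a factor
  \<open>N - r \<ge> L\<close> in the denominator.\<close>

lemma pair_sum_containing_point_le:
  assumes F: "\<F> \<subseteq> perm_family n" "\<forall>A \<in> \<F>. B \<subseteq> A"
    and R: "R \<subseteq> {1..n} - fst ` B" and C: "C \<subseteq> {1..n} - snd ` B"
    and spread: "\<And>S. S \<inter> B' = {} \<Longrightarrow>
      real (card {A \<in> \<G>. S \<subseteq> A}) * falling (real N) (card S) \<le> \<tau> ^ card S * real (card \<G>)"
    and RC: "R \<times> C \<inter> B' = {}" and y: "y \<notin> B'" "y \<notin> R \<times> C"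
    and L: "card R \<le> N" "r \<le> N" "0 < L" "L \<le> real N - real r" and tau: "0 \<le> \<tau>"
  shows "fact r * (\<Sum>S\<in>matchings R C r. real (card {A \<in> \<F>. S \<subseteq> A}) * real (card {A \<in> \<G>. insert y S \<subseteq> A}))
    \<le> \<tau> ^ (r + 1) / L * real (card \<F>) * real (card \<G>)"
proof -
  have fin: "finite R" "finite C" using R C finite_subset by blast+
  have pos: "0 < falling (real N) r" using L by (intro falling_pos) auto
  have "fact r * (\<Sum>S\<in>matchings R C r. real (card {A \<in> \<G>. insert y S \<subseteq> A}) * real (card {A \<in> \<F>. S \<subseteq> A}))
    \<le> \<tau> ^ (r + 1) / L * real (card \<G>) * real (card \<F>)"
  proof (rule pair_sum_upper_bound[where x = "falling (real N) r" and y = "falling (real (card R)) r"])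
    fix S assume S: "S \<in> matchings R C r"
    then have SRC: "S \<subseteq> R \<times> C" "card S = r" by (auto simp: matchings_def)
    have "finite S" using SRC fin finite_subset by blast
    moreover have "y \<notin> S" using SRC(1) y(2) by blast
    ultimately have c: "card (insert y S) = r + 1" using SRC(2) by simp
    have "insert y S \<inter> B' = {}" using SRC RC y by auto
    from spread[OF this] have
      *: "real (card {A \<in> \<G>. insert y S \<subseteq> A}) * (falling (real N) r * (real N - real r)) \<le> \<tau> ^ (r + 1) * real (card \<G>)"
      unfolding c by (simp add: falling_Suc)
    have "real (card {A \<in> \<G>. insert y S \<subseteq> A}) * falling (real N) r * L
        \<le> real (card {A \<in> \<G>. insert y S \<subseteq> A}) * falling (real N) r * (real N - real r)"
      using L pos by (intro mult_left_mono) auto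
    also have "\<dots> \<le> \<tau> ^ (r + 1) * real (card \<G>)" using * by (simp add: mult.assoc)
    finally show "real (card {A \<in> \<G>. insert y S \<subseteq> A}) * falling (real N) r \<le> \<tau> ^ (r + 1) / L * real (card \<G>)"
      using L by (simp add: field_simps)
  next
    show "fact r * (\<Sum>S\<in>matchings R C r. real (card {A \<in> \<F>. S \<subseteq> A})) \<le> real (card \<F>) * falling (card R) r"
      by (rule sum_card_matchings_bounds(1)[OF F R C])
    show "falling (real (card R)) r \<le> falling (real N) r" by (intro falling_nat_mono L)
  qed (use pos L tau in auto)
  then show ?thesis by (simp add: mult_ac)
qed

text \<open>If no such pair exists, every pair with \<open>Z = r\<close> also meets in
  \<open>\<Delta>\<close>. The contradiction comes from two estimates of \<open>V\<close>, which
  counts these extra points with weight \<open>falling Z r\<close>.\<close>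

lemma exists_pair_with_intersection:
  fixes n t :: nat and m :: real
  defines "\<tau> \<equiv> 2 powr (1 / (8 * real t))"
  assumes size: "32 * real t * m \<le> n" "192 * m \<le> n" "1000 * (t + 2) \<le> n"
    and B1: "partial_permutation n B1" "real (card B1) \<le> m"
    and B2: "partial_permutation n B2" "real (card B2) \<le> m"
    and Int: "card (B1 \<inter> B2) < t"
    and F1: "\<F>1 \<subseteq> perm_family n" "\<forall>A \<in> \<F>1. B1 \<subseteq> A"
    and hom1: "homogeneous (link (perm_family n) B1) \<tau> (link \<F>1 B1)"
    and F2: "\<F>2 \<subseteq> perm_family n" "\<forall>A \<in> \<F>2. B2 \<subseteq> A"
    and hom2: "homogeneous (link (perm_family n) B2) \<tau> (link \<F>2 B2)"
  shows "\<exists>A \<in> \<F>1. \<exists>A' \<in> \<F>2. card (A \<inter> A') = t - 1"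
proof (rule ccontr)
  assume "\<not> ?thesis"
  then have none: "card (A \<inter> A') \<noteq> t - 1" if "A \<in> \<F>1" "A' \<in> \<F>2" for A A'
    using that by blast
  define r where "r = t - 1 - card (B1 \<inter> B2)"
  have r: "r < t" "card (B1 \<inter> B2) + r = t - 1" using Int by (auto simp: r_def)
  define R where "R = {1..n} - fst ` B1 - fst ` B2"
  define C where "C = {1..n} - snd ` B1 - snd ` B2"
  define \<Delta> where "\<Delta> = (B1 - B2) \<union> (B2 - B1)"
  define N1 where "N1 = n - card B1"
  define N2 where "N2 = n - card B2"
  \<comment> \<open>The missing 2 percent of \<open>n\<close> cover
    \<open>card B1 + card B2 \<le> 2 * m \<le> n / 96\<close> and
    \<open>j \<le> n / 1000\<close>.\<close>
  define L where "L = 49/50 * real n"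
  define a where "a = real (card \<F>1)"
  define b where "b = real (card \<F>2)"
  note P1 = partial_permutation_card[OF B1(1)] and P2 = partial_permutation_card[OF B2(1)]
  have tau: "1 < \<tau>" using hom1 by (simp add: homogeneous_def)
  have fin: "finite R" "finite C" unfolding R_def C_def by auto
  have RC1: "R \<subseteq> {1..n} - fst ` B1" "C \<subseteq> {1..n} - snd ` B1"
    and RC2: "R \<subseteq> {1..n} - fst ` B2" "C \<subseteq> {1..n} - snd ` B2"
    unfolding R_def C_def by auto
  have RCB: "R \<times> C \<inter> B1 = {}" "R \<times> C \<inter> B2 = {}" unfolding R_def by force+
  have n0: "0 < real n" using size by simp
  have m0: "0 \<le> m" using B1(2) by linarith
  have L0: "0 < L" using n0 by (simp add: L_def)
  have R_card: "card R \<le> N1" "card R \<le> N2" "n \<le> card R + card B1 + card B2"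
    using card_Diff_Diff_bounds[OF P1(5) P2(5)] P1(3) P2(3) by (simp_all add: R_def N1_def N2_def)
  have C_card: "card C \<le> N1" "card C \<le> N2" "n \<le> card C + card B1 + card B2"
    using card_Diff_Diff_bounds[OF P1(6) P2(6)] P1(4) P2(4) by (simp_all add: C_def N1_def N2_def)
  have N1: "real N1 = real n - real (card B1)" and N2: "real N2 = real n - real (card B2)"
    using P1(2) P2(2) by (simp_all add: N1_def N2_def)
  have RN: "0 \<le> real N1 - card R" "real N1 - card R \<le> m" "0 \<le> real N2 - card R" "real N2 - card R \<le> m"
    using R_card N1 N2 B1(2) B2(2) by linarith+
  have CN: "0 \<le> real N1 - card C" "real N1 - card C \<le> m" "0 \<le> real N2 - card C" "real N2 - card C \<le> m"
    using C_card N1 N2 B1(2) B2(2) by linarith+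
  have big: "L + real j \<le> card R" "L + real j \<le> card C" if "j \<le> t + 2" for j
  proof -
    have "1000 * j \<le> n" using that size(3) by simp
    then have "1000 * real j \<le> real n" using of_nat_mono[of "1000 * j" n, where 'a = real] by simp
    then show "L + real j \<le> card R" "L + real j \<le> card C"
      using RN CN N1 N2 B1(2) B2(2) size(2) unfolding L_def by linarith+
  qed
  have jN: "j \<le> card R" "j \<le> N1" "j \<le> N2" if "j \<le> t + 2" for j
    using big(1)[OF that] L0 R_card by linarith+
  have mL: "2 * m \<le> L" using size(2) n0 m0 unfolding L_def by linarith
  note h1 = homogeneous_linkD[OF B1(1) F1 hom1] and h2 = homogeneous_linkD[OF B2(1) F2 hom2]
  have ne: "\<F>1 \<noteq> {}" "\<F>2 \<noteq> {}" using h1(1)[of "{}"] h2(1)[of "{}"] by auto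
  have fF: "finite \<F>1" "finite \<F>2" using F1 F2 finite_perm_family finite_subset by blast+
  have ab: "0 < a" "0 < b" unfolding a_def b_def using ne fF by (simp_all add: card_gt_0_iff)
  define f where "f S = real (card {A \<in> \<F>1. S \<subseteq> A})" for S
  define g where "g S = real (card {A \<in> \<F>2. S \<subseteq> A})" for S
  define W where "W j = (\<Sum>(A, A')\<in>\<F>1 \<times> \<F>2. falling (card (A \<inter> A' \<inter> R \<times> C)) j)" for j
  have W: "W j = fact j * (\<Sum>S\<in>matchings R C j. f S * g S)" for j
    unfolding W_def f_def g_def by (rule sum_falling_pair_Int[OF F1(1) F2(1) fin])
  have fS: "f S * falling N1 j \<le> \<tau> ^ j * a" and gS: "g S * falling N2 j \<le> \<tau> ^ j * b"
    if "S \<in> matchings R C j" for S j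
  proof -
    have S: "S \<inter> B1 = {}" "S \<inter> B2 = {}" "card S = j" using that RCB by (auto simp: matchings_def)
    show "f S * falling N1 j \<le> \<tau> ^ j * a" "g S * falling N2 j \<le> \<tau> ^ j * b"
      using h1(2)[OF S(1)] h2(2)[OF S(2)] S(3) by (simp_all add: f_def g_def a_def b_def N1_def N2_def)
  qed
  have sum_f: "a * falling (card R + card C - N1) j \<le> fact j * sum f (matchings R C j)" for j
    using sum_card_matchings_bounds(2)[OF F1 RC1] by (simp add: f_def a_def N1_def)
  have sum_g: "b * falling (card R + card C - N2) j \<le> fact j * sum g (matchings R C j)"
    "fact j * sum g (matchings R C j) \<le> b * falling (card R) j" for j
    using sum_card_matchings_bounds[OF F2 RC2] by (simp_all add: g_def b_def N2_def)
  \<comment> \<open>Homogeneity bounds \<open>f\<close> pointwise, and the grid bounds the total of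
    \<open>g\<close>.\<close>
  have upper: "W j \<le> \<tau> ^ j * a * b" if "j \<le> t + 2" for j
    unfolding W
  proof (rule pair_sum_upper_bound[OF fS _ sum_g(2)])
    show "0 < falling N1 j" using jN(2)[OF that] by (intro falling_pos) auto
    show "falling (card R) j \<le> falling N1 j" by (intro falling_nat_mono R_card)
  qed (use tau ab in \<open>auto simp: g_def\<close>)
  define lo where "lo = (\<lambda>j. (1 - real j * (2 * m / L)) * (\<tau> ^ j * (2 * (1 - real j * (m / L)\<^sup>2) - \<tau> ^ j)))"
  have lower: "lo j * a * b \<le> W j"
    if j: "j \<le> t + 2" and U: "0 \<le> 2 * (1 - real j * (m / L)\<^sup>2) - \<tau> ^ j" for j
    unfolding W lo_def
  proof (rule pair_sum_lower_bound[OF fS gS sum_f sum_g(1) fact_times_card_matchings_le[OF fin]])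
    \<comment> \<open>The grid is large enough that the natural subtraction does not
      truncate.\<close>
    have K1: "real (card R + card C - N1) = real (card R) + real (card C) - real N1"
      and K2: "real (card R + card C - N2) = real (card R) + real (card C) - real N2"
      using RN CN big[OF j] mL L0 m0 by linarith+
    show "(1 - real j * (m / L)\<^sup>2) * (falling (card R) j * falling (card C) j)
        \<le> falling (card R + card C - N1) j * falling N1 j"
      unfolding K1 by (rule falling_excess_lower_bound) (use L0 mL m0 RN CN big[OF j] in auto)
    show "(1 - real j * (m / L)\<^sup>2) * (falling (card R) j * falling (card C) j)
        \<le> falling (card R + card C - N2) j * falling N2 j"
      unfolding K2 by (rule falling_excess_lower_bound) (use L0 mL m0 RN CN big[OF j] in auto)
    show "(1 - real j * (2 * m / L)) * (falling N1 j * falling N2 j)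
        \<le> falling (card R) j * falling (card C) j"
      by (rule falling_ratio_lower_bound) (use L0 mL RN CN big[OF j] in auto)
    show "0 < falling N1 j" "0 < falling N2 j" using jN[OF j] by (auto intro: falling_pos)
  qed (use tau ab U in auto)
  \<comment> \<open>On pairs with \<open>Z = r\<close> the first factor is \<open>fact r\<close>,
    matching the right side of \<open>bonferroni_binomial\<close>. The number of points in
    \<open>\<Delta>\<close>, rather than an indicator, makes \<open>V\<close> a sum over single
    points.\<close>
  define V where "V = (\<Sum>(A, A')\<in>\<F>1 \<times> \<F>2. falling (card (A \<inter> A' \<inter> R \<times> C)) r * card (A \<inter> A' \<inter> \<Delta>))"
  have "W r - W (r + 1) + W (r + 2) / 2 - W (r + 3) / 6 \<le> V"
  proof -
    have "W r - W (r + 1) + W (r + 2) / 2 - W (r + 3) / 6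
      = (\<Sum>(A, A')\<in>\<F>1 \<times> \<F>2. falling (card (A \<inter> A' \<inter> R \<times> C)) r - falling (card (A \<inter> A' \<inter> R \<times> C)) (r + 1)
          + falling (card (A \<inter> A' \<inter> R \<times> C)) (r + 2) / 2 - falling (card (A \<inter> A' \<inter> R \<times> C)) (r + 3) / 6)"
      unfolding W_def case_prod_beta by (simp add: sum.distrib sum_subtractf sum_divide_distrib)
    also have "\<dots> \<le> V"
      unfolding V_def
    proof (rule sum_mono, clarify)
      fix A A' assume A: "A \<in> \<F>1" "A' \<in> \<F>2"
      let ?Z = "card (A \<inter> A' \<inter> R \<times> C)" and ?Y = "card (A \<inter> A' \<inter> \<Delta>)"
      have "card (A \<inter> A') = card (B1 \<inter> B2) + ?Y + ?Z"
        unfolding R_def C_def \<Delta>_def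
        by (rule card_Int_decomposition) (use A F1 F2 in auto)
      \<comment> \<open>With \<open>?Z = r\<close> and \<open>?Y = 0\<close> the pair would meet in
        exactly \<open>t - 1\<close> points.\<close>
      then have "?Z = r \<Longrightarrow> 1 \<le> ?Y" using none[OF A] r(2) by (cases "?Y = 0") auto
      then have "(if ?Z = r then fact r else 0) \<le> falling ?Z r * real ?Y"
        by (auto simp: falling_self falling_nat_nonneg)
      then show "falling ?Z r - falling ?Z (r + 1) + falling ?Z (r + 2) / 2 - falling ?Z (r + 3) / 6
          \<le> falling ?Z r * real ?Y"
        using bonferroni_binomial[of ?Z r] by linarith
    qed
    finally show ?thesis .
  qed
  moreover have "V \<le> 2 * m * \<tau> ^ (r + 1) / L * a * b"
  proof -
    let ?F = "\<lambda>y. {A \<in> \<F>1. y \<in> A}" and ?G = "\<lambda>y. {A \<in> \<F>2. y \<in> A}"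
    let ?T = "\<lambda>y. \<Sum>(A, A')\<in>?F y \<times> ?G y. falling (card (A \<inter> A' \<inter> R \<times> C)) r"
    have fD: "finite \<Delta>" using P1(1) P2(1) by (simp add: \<Delta>_def)
    have "V = (\<Sum>x\<in>\<F>1 \<times> \<F>2. \<Sum>y\<in>\<Delta>. if y \<in> fst x \<and> y \<in> snd x then falling (card (fst x \<inter> snd x \<inter> R \<times> C)) r else 0)"
      unfolding V_def case_prod_beta using fD
      by (intro sum.cong refl) (simp add: sum.If_cases Int_def conj_ac mult.commute)
    also have "\<dots> = (\<Sum>y\<in>\<Delta>. \<Sum>x\<in>\<F>1 \<times> \<F>2. if y \<in> fst x \<and> y \<in> snd x then falling (card (fst x \<inter> snd x \<inter> R \<times> C)) r else 0)"
      by (rule sum.swap)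
    also have "\<dots> = (\<Sum>y\<in>\<Delta>. ?T y)"
    proof (rule sum.cong[OF refl])
      fix y
      have "?F y \<times> ?G y = {x \<in> \<F>1 \<times> \<F>2. y \<in> fst x \<and> y \<in> snd x}" by auto
      then show "(\<Sum>x\<in>\<F>1 \<times> \<F>2. if y \<in> fst x \<and> y \<in> snd x then falling (card (fst x \<inter> snd x \<inter> R \<times> C)) r else 0) = ?T y"
        unfolding case_prod_beta using fF by (simp only: sum.inter_filter[OF finite_cartesian_product])
    qed
    also have "\<dots> \<le> (\<Sum>y\<in>\<Delta>. \<tau> ^ (r + 1) / L * a * b)"
    proof (rule sum_mono)
      fix y assume y: "y \<in> \<Delta>"
      \<comment> \<open>Fixing \<open>y\<close> in both members gives a moment of two
        subfamilies.\<close>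
      have T: "?T y = fact r * (\<Sum>S\<in>matchings R C r. real (card {A \<in> ?F y. S \<subseteq> A}) * real (card {A \<in> ?G y. S \<subseteq> A}))"
        by (rule sum_falling_pair_Int) (use F1(1) F2(1) fin in auto)
      have yRC: "y \<notin> R \<times> C" using y RCB by (auto simp: \<Delta>_def)
      have Lr: "r \<le> N1" "r \<le> N2" "L \<le> real N1 - real r" "L \<le> real N2 - real r"
        using jN[of r] big(1)[of r] RN r(1) by linarith+
      \<comment> \<open>All members of the family whose base set has \<open>y\<close> contain it, so
        the condition restricts only the other family.\<close>
      from y consider "y \<in> B1" "y \<notin> B2" | "y \<in> B2" "y \<notin> B1" by (auto simp: \<Delta>_def)
      then show "?T y \<le> \<tau> ^ (r + 1) / L * a * b"
      proof cases
        case 1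
        have "{A \<in> ?F y. S \<subseteq> A} = {A \<in> \<F>1. S \<subseteq> A}" "{A \<in> ?G y. S \<subseteq> A} = {A \<in> \<F>2. insert y S \<subseteq> A}" for S
          using F1(2) 1 by auto
        moreover have "fact r * (\<Sum>S\<in>matchings R C r. real (card {A \<in> \<F>1. S \<subseteq> A}) * real (card {A \<in> \<F>2. insert y S \<subseteq> A}))
            \<le> \<tau> ^ (r + 1) / L * real (card \<F>1) * real (card \<F>2)"
          by (rule pair_sum_containing_point_le[OF F1 RC1 h2(2) RCB(2) 1(2) yRC])
            (use R_card Lr L0 tau in \<open>auto simp: N2_def\<close>)
        ultimately show ?thesis unfolding T a_def b_def by simp
      next
        case 2
        have "{A \<in> ?G y. S \<subseteq> A} = {A \<in> \<F>2. S \<subseteq> A}" "{A \<in> ?F y. S \<subseteq> A} = {A \<in> \<F>1. insert y S \<subseteq> A}" for S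
          using F2(2) 2 by auto
        moreover have "fact r * (\<Sum>S\<in>matchings R C r. real (card {A \<in> \<F>2. S \<subseteq> A}) * real (card {A \<in> \<F>1. insert y S \<subseteq> A}))
            \<le> \<tau> ^ (r + 1) / L * real (card \<F>2) * real (card \<F>1)"
          by (rule pair_sum_containing_point_le[OF F2 RC2 h1(2) RCB(1) 2(2) yRC])
            (use R_card Lr L0 tau in \<open>auto simp: N1_def\<close>)
        ultimately show ?thesis unfolding T a_def b_def by (simp add: mult_ac)
      qed
    qed
    also have "\<dots> = real (card \<Delta>) * (\<tau> ^ (r + 1) / L * a * b)" by simp
    also have "\<dots> \<le> (2 * m) * (\<tau> ^ (r + 1) / L * a * b)"
    proof (rule mult_right_mono)
      have "card \<Delta> \<le> card (B1 - B2) + card (B2 - B1)" unfolding \<Delta>_def by (rule card_Un_le)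
      moreover have "card (B1 - B2) \<le> card B1" "card (B2 - B1) \<le> card B2"
        using P1(1) P2(1) by (auto intro: card_mono)
      ultimately show "real (card \<Delta>) \<le> 2 * m" using B1(2) B2(2) by linarith
    qed (use tau L0 ab in auto)
    finally show ?thesis by (simp add: mult_ac)
  qed
  moreover have "2 * m * \<tau> ^ (r + 1) / L * a * b < W r - W (r + 1) + W (r + 2) / 2 - W (r + 3) / 6"
  proof -
    note num = bonferroni_numeric_bound[OF n0 m0 size(1,2) L_def r(1), folded \<tau>_def]
    have "2 * m * \<tau> ^ (r + 1) / L * (a * b) < (lo r - \<tau> ^ (r + 1) + lo (r + 2) / 2 - \<tau> ^ (r + 3) / 6) * (a * b)"
      using num(3) ab unfolding lo_def by (intro mult_strict_right_mono) auto
    also have "\<dots> = lo r * a * b - \<tau> ^ (r + 1) * a * b + lo (r + 2) * a * b / 2 - \<tau> ^ (r + 3) * a * b / 6"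
      by (simp add: algebra_simps)
    also have "\<dots> \<le> W r - W (r + 1) + W (r + 2) / 2 - W (r + 3) / 6"
      using lower[OF _ num(1)] lower[OF _ num(2)] upper[of "r + 1"] upper[of "r + 3"] r(1) by simp
    finally show ?thesis by (simp add: mult.assoc)
  qed
  ultimately show False by linarith
qed

lemma log2_le_linear:
  fixes x :: real
  assumes "2 ^ 22 \<le> x"
  shows "22 \<le> log 2 x" and "log 2 x \<le> 22 * (x / 2 ^ 22)"
proof -
  define z where "z = x / 2 ^ 22"
  have z: "1 \<le> z" "x = 2 ^ 22 * z" using assms by (simp_all add: z_def)
  have "log 2 x = log 2 (2 ^ 22) + log 2 z"
    unfolding z(2) using z(1) by (intro log_mult_pos) auto
  also have "log 2 (2 ^ 22 :: real) = 22" by (subst log_nat_power) simp_all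
  finally have l: "log 2 x = 22 + log 2 z" .
  then show "22 \<le> log 2 x" using z(1) by simp
  have "log 2 z = ln z / ln 2" by (simp add: log_def)
  \<comment> \<open>\<open>ln 2 \<ge> 1/2\<close> comes from the tangent bound at 1/2. The resulting
    slope 2 is below 22.\<close>
  also have "\<dots> \<le> (z - 1) / (1/2)"
    using ln_le_minus_one[of z] ln_le_minus_one[of "1/2 :: real"] z(1)
    by (intro frac_le) (auto simp: ln_div)
  finally show "log 2 x \<le> 22 * (x / 2 ^ 22)" using l z(1) unfolding z_def[symmetric] by simp
qed

theorem theorem9:
  fixes n t :: nat and \<F> :: "(nat \<times> nat) set set" and q :: real
  assumes "n \<ge> 1" and "t \<ge> 1"
    and "n \<ge> 2 ^ 22"
    and "real n \<ge> 2 ^ 10 * real t ^ 3 * log 2 (real n)"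
    and "\<F> \<subseteq> perm_family n"
    and "avoids_intersection \<F> (t - 1)"
    and "q = 32 * real t ^ 2 * log 2 (real n)"
  shows "\<exists>\<S> \<F>'.
      t_intersecting t \<S> \<and>
      (\<forall>B \<in> \<S>. partial_permutation n B \<and> real (card B) \<le> q) \<and>
      \<F>' \<subseteq> \<F> \<and>
      (\<forall>\<sigma> \<in> \<F> - \<F>'. \<exists>B \<in> \<S>. B \<subseteq> \<sigma>) \<and>
      (\<forall>B \<in> \<S>. \<exists>\<F>B. \<F>B \<subseteq> \<F> \<and> (\<forall>\<sigma> \<in> \<F>B. B \<subseteq> \<sigma>) \<and>
          homogeneous (link (perm_family n) B) (2 powr (1 / (8 * real t))) (link \<F>B B)) \<and>
      real (card \<F>') \<le> real n powr (- (4 * real t)) * fact n"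
proof -
  let ?l = "log 2 (real n)" and ?\<tau> = "2 powr (1 / (8 * real t))"
  have n22: "2 ^ 22 \<le> real n" using assms(3) by (metis of_nat_le_iff of_nat_numeral of_nat_power)
  note l = log2_le_linear[OF n22]
  have t1: "1 \<le> real t" using assms(2) by simp
  have size1: "32 * real t * q \<le> real n"
    using assms(4) unfolding assms(7) by (simp add: power2_eq_square power3_eq_cube mult_ac)
  \<comment> \<open>For small \<open>t\<close> the bound comes from \<open>n \<ge> 2 ^ 22\<close>,
    since 192 * 800 * 22 < 2^22; from \<open>t = 6\<close> on, \<open>192 \<le> 32 * t\<close>
    reduces it to \<open>size1\<close>.\<close>
  have size2: "192 * q \<le> real n"
  proof (cases "t \<le> 5")
    case True
    then have "real t ^ 2 \<le> 5 ^ 2" by (intro power_mono) auto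
    then have "q \<le> 32 * 25 * ?l" unfolding assms(7) using l(1) by (intro mult_mono) auto
    then show ?thesis using l(2) by simp
  next
    case False
    then have "6 \<le> real t" by simp
    then have "192 * q \<le> 32 * real t * q"
      using l(1) unfolding assms(7) by (intro mult_right_mono) auto
    then show ?thesis using size1 by linarith
  qed
  have size3: "1000 * (t + 2) \<le> n"
  proof -
    have "real t * 1 * 1 \<le> real t * real t * real t" using t1 by (intro mult_mono) auto
    then have "real t \<le> real t ^ 3" by (simp add: power3_eq_cube)
    then have "2 ^ 10 * real t * 22 \<le> 2 ^ 10 * real t ^ 3 * ?l"
      using l(1) t1 by (intro mult_mono) auto
    then have "real (1000 * (t + 2)) \<le> real n" using assms(4) n22 by simp
    then show ?thesis by (simp only: of_nat_le_iff)
  qed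
  have tau: "1 < ?\<tau>" using t1 by simp
  \<comment> \<open>\<open>q\<close> is chosen so that
    \<open>q / (8 * t) = 4 * t * log 2 n\<close>.\<close>
  have decay: "?\<tau> powr (- q) = real n powr (- (4 * real t))"
  proof -
    have "?\<tau> powr (- q) = 2 powr (?l * (- (4 * real t)))"
      unfolding powr_powr assms(7) using t1 by (simp add: power2_eq_square field_simps)
    also have "\<dots> = (2 powr ?l) powr (- (4 * real t))" by (simp add: powr_powr)
    also have "2 powr ?l = real n" using n22 by simp
    finally show ?thesis .
  qed
  obtain \<S> \<F>' where S: "\<forall>B \<in> \<S>. partial_permutation n B \<and> real (card B) \<le> q"
    and F': "\<F>' \<subseteq> \<F>" "\<forall>\<sigma> \<in> \<F> - \<F>'. \<exists>B \<in> \<S>. B \<subseteq> \<sigma>"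
    and hom: "\<forall>B \<in> \<S>. \<exists>\<F>B. \<F>B \<subseteq> \<F> \<and> (\<forall>\<sigma> \<in> \<F>B. B \<subseteq> \<sigma>) \<and>
          homogeneous (link (perm_family n) B) ?\<tau> (link \<F>B B)"
    and card: "real (card \<F>') \<le> ?\<tau> powr (- q) * fact n"
    using greedy_decomposition[OF tau assms(5), of q] by (elim exE conjE) (rule that; assumption)
  have inter: "t_intersecting t \<S>"
    unfolding t_intersecting_def
  proof (intro ballI, rule ccontr)
    fix B1 B2 assume B: "B1 \<in> \<S>" "B2 \<in> \<S>" and "\<not> t \<le> card (B1 \<inter> B2)"
    then have Int: "card (B1 \<inter> B2) < t" by simp
    obtain \<F>1 where F1: "\<F>1 \<subseteq> \<F>" "\<forall>\<sigma> \<in> \<F>1. B1 \<subseteq> \<sigma>"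
      "homogeneous (link (perm_family n) B1) ?\<tau> (link \<F>1 B1)" using bspec[OF hom B(1)] by metis
    obtain \<F>2 where F2: "\<F>2 \<subseteq> \<F>" "\<forall>\<sigma> \<in> \<F>2. B2 \<subseteq> \<sigma>"
      "homogeneous (link (perm_family n) B2) ?\<tau> (link \<F>2 B2)" using bspec[OF hom B(2)] by metis
    have "\<exists>A \<in> \<F>1. \<exists>A' \<in> \<F>2. card (A \<inter> A') = t - 1"
      using exists_pair_with_intersection[OF size1 size2 size3 _ _ _ _ Int _ F1(2,3) _ F2(2,3)]
        bspec[OF S B(1)] bspec[OF S B(2)] F1(1) F2(1) assms(5) by auto
    then show False using assms(6) F1(1) F2(1) unfolding avoids_intersection_def by blast
  qed
  show ?thesis
    by (rule exI[of _ \<S>], rule exI[of _ \<F>']) (intro conjI inter S F' hom card[unfolded decay])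
qed

end
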